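(* Consider an MDSP instance with $m$ drones and let $\Delta$ be the maximum degree of the interval graph of the delivery intervals. If $m\ge\Delta$, then the algorithm GreedyAlgoForMDSP (described in the context) is a polynomial-time algorithm that outputs a feasible solution for the instance with $m$ drones whose total profit is at least $\frac14 f(m)$.
   Context: An MDSP instance consists of deliveries $\mathcal{N}=\{1,\dots,n\}$ and $m$ drones, each with the same battery budget $B>0$. Each delivery $j$ has a closed delivery time interval $I_j=[t_j^L,t_j^R]$, a cost $c_j>0$ with $c_j\le B$, and a profit $p_j\ge 0$. Deliveries $j\ne k$ are compatible if $I_j\cap I_k=\emptyset$. A set $S\subseteq\mathcal{N}$ is compatible if its elements are pairwise compatible and feasible if additionally $\mathcal{W}(S)=\sum_{j\in S}c_j\le B$; its profit is $\mathcal{P}(S)=\sum_{j\in S}p_j$. A feasible solution is a family $S_1,\dots,S_m$ of pairwise disjoint feasible sets; its profit is $\sum_i\mathcal{P}(S_i)$, and $f(m)$ denotes the maximum profit of a feasible solution. The density of $j$ is $d_j=p_j/c_j$. The interval graph has vertex set $\mathcal{N}$ and an edge between $j\neq k$ iff $I_j\cap I_k\neq\emptyset$; $\Delta$ is its maximum degree. Algorithm GreedyAlgoForMDSP: Use $m+\Delta$ slots $i=1,\dots,m+\Delta$, each with a set $S_i$ (initially $\emptyset$), cost $W_i=\mathcal{W}(S_i)$ and profit $P_i=\mathcal{P}(S_i)$; let $M$ (initially all slots) be the open slots and $M'$ (initially $\emptyset$) the closed slots. Sort the deliveries so that $d_1\ge d_2\ge\dots\ge d_n$. For $j=1,\dots,n$: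 if $|M'|=m$, stop the loop; otherwise choose a slot $i\in M$ such that $I_j$ is disjoint from every interval $I_k$ with $k\in S_i$, and add $j$ to $S_i$ (updating $W_i,P_i$); if now $W_i>B$, move $i$ from $M$ to $M'$ and set $L_i=\{j\}$. After the loop, for each $i\in M'$: if $\mathcal{P}(S_i\setminus L_i)\ge\mathcal{P}(L_i)$, replace $S_i$ by $S_i\setminus L_i$; otherwise replace $S_i$ by $L_i$ (updating $W_i,P_i$). Finally output the $m$ slots with the largest $P_i$ among all $m+\Delta$ slots, together with their sets $S_i$. *)

theory Defs
  imports
    Complex_Main
    "HOL-Library.Monad_Syntax"
    "HOL-Library.Log_Nat"
    "HOL-Computational_Algebra.Polynomial"
begin

section \<open>The multiple drone-delivery scheduling problem\<close>

record mdsp =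
  num_deliveries :: nat
  num_drones :: nat
  budget :: real
  t_left :: "nat \<Rightarrow> real"
  t_right :: "nat \<Rightarrow> real"
  cost :: "nat \<Rightarrow> real"
  profit :: "nat \<Rightarrow> real"

definition deliveries :: "mdsp \<Rightarrow> nat set" where
  "deliveries I = {1..num_deliveries I}"

definition mdsp_instance :: "mdsp \<Rightarrow> bool" where
  "mdsp_instance I \<longleftrightarrow> budget I > 0 \<and>
     (\<forall>j\<in>deliveries I. t_left I j \<le> t_right I j \<and> 0 < cost I j \<and> cost I j \<le> budget I
                      \<and> 0 \<le> profit I j)"

definition interval :: "mdsp \<Rightarrow> nat \<Rightarrow> real set" where
  "interval I j = {t_left I j..t_right I j}"

definition compatible :: "mdsp \<Rightarrow> nat set \<Rightarrow> bool" where
  "compatible I S \<longleftrightarrow> pairwise (\<lambda>j k. interval I j \<inter> interval I k = {}) S"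

definition set_cost :: "mdsp \<Rightarrow> nat set \<Rightarrow> real" where
  "set_cost I S = (\<Sum>j\<in>S. cost I j)"

definition set_profit :: "mdsp \<Rightarrow> nat set \<Rightarrow> real" where
  "set_profit I S = (\<Sum>j\<in>S. profit I j)"

definition feasible_set :: "mdsp \<Rightarrow> nat set \<Rightarrow> bool" where
  "feasible_set I S \<longleftrightarrow> S \<subseteq> deliveries I \<and> compatible I S \<and> set_cost I S \<le> budget I"

text \<open>A family of \<open>m\<close> sets is a list of length \<open>m\<close>. Disjointness is required between different
  positions, so that only the empty set may occur repeatedly. The number of drones is an argument
  of its own, because \<open>f\<close> is a function of it.\<close>

definition feasible_solution :: "mdsp \<Rightarrow> nat \<Rightarrow> nat set list \<Rightarrow> bool" where
  "feasible_solution I m Ss \<longleftrightarrow> length Ss = m \<and> (\<forall>S\<in>set Ss. feasible_set I S) \<and>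
     (\<forall>a<m. \<forall>b<m. a \<noteq> b \<longrightarrow> Ss ! a \<inter> Ss ! b = {})"

definition total_profit :: "mdsp \<Rightarrow> nat set list \<Rightarrow> real" where
  "total_profit I Ss = (\<Sum>S\<leftarrow>Ss. set_profit I S)"

definition opt_profit :: "mdsp \<Rightarrow> nat \<Rightarrow> real" where
  "opt_profit I m = Max {total_profit I Ss | Ss. feasible_solution I m Ss}"

definition neighbours :: "mdsp \<Rightarrow> nat \<Rightarrow> nat set" where
  "neighbours I j = {k \<in> deliveries I. k \<noteq> j \<and> interval I j \<inter> interval I k \<noteq> {}}"

text \<open>The inserted \<open>0\<close> only matters when there are no deliveries.\<close>

definition max_degree :: "mdsp \<Rightarrow> nat" where
  "max_degree I = Max (insert 0 ((\<lambda>j. card (neighbours I j)) ` deliveries I))"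


section \<open>Nondeterministic computations with a step count\<close>

text \<open>A computation is the set of the outcomes of all its runs. A run that ends with result \<open>x\<close>
  after \<open>t\<close> steps contributes \<open>Some (x, t)\<close>; a run that gets stuck, because it has to choose from
  an empty list, contributes \<open>None\<close>. Nondeterminism is used where the algorithm does not prescribe
  a choice: the slot that receives a delivery, and ties in sorting.\<close>

datatype 'a comp = Comp (outcomes: "('a \<times> nat) option set")

definition return :: "'a \<Rightarrow> 'a comp" where
  "return x = Comp {Some (x, 0)}"

definition tick :: "nat \<Rightarrow> unit comp" where
  "tick t = Comp {Some ((), t)}"

definition pick :: "'a list \<Rightarrow> 'a comp" where
  "pick xs = Comp (if xs = [] then {None} else (\<lambda>x. Some (x, length xs)) ` set xs)"

definition bind_comp :: "'a comp \<Rightarrow> ('a \<Rightarrow> 'b comp) \<Rightarrow> 'b comp" where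
  "bind_comp c f = Comp (\<Union>r\<in>outcomes c. case r of
       None \<Rightarrow> {None}
     | Some (x, t) \<Rightarrow> map_option (\<lambda>(y, u). (y, t + u)) ` outcomes (f x))"

adhoc_overloading Monad_Syntax.bind \<rightleftharpoons> bind_comp

definition guarantees :: "'a comp \<Rightarrow> ('a \<Rightarrow> nat \<Rightarrow> bool) \<Rightarrow> bool" where
  "guarantees c Q \<longleftrightarrow> outcomes c \<noteq> {} \<and> (\<forall>r\<in>outcomes c. \<exists>x t. r = Some (x, t) \<and> Q x t)"


section \<open>The greedy algorithm\<close>

text \<open>The functions of type \<open>nat \<Rightarrow> _\<close> in the state play the role of arrays indexed by slots. The
  set of a slot is kept as a list. A slot \<open>i\<close> has \<open>last_added i\<close> equal to \<open>[]\<close> until it is closed.\<close>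

record greedy_state =
  open_slots :: "nat list"
  closed_slots :: "nat list"
  slot_set :: "nat \<Rightarrow> nat list"
  slot_cost :: "nat \<Rightarrow> real"
  slot_profit :: "nat \<Rightarrow> real"
  last_added :: "nat \<Rightarrow> nat list"

text \<open>\<open>C x y\<close> is the number of steps charged for one arithmetic operation or comparison on the
  numbers \<open>x\<close> and \<open>y\<close>. Array accesses and operations on indices take constant time and are covered
  by the \<open>tick\<close> of the list traversal they occur in; a list operation that is not spelled out
  as a recursion is charged explicitly.\<close>

context
  fixes C :: "real \<Rightarrow> real \<Rightarrow> nat"
begin

definition num_add :: "real \<Rightarrow> real \<Rightarrow> real comp" where
  "num_add x y = do { tick (C x y); return (x + y) }"

definition num_div :: "real \<Rightarrow> real \<Rightarrow> real comp" where
  "num_div x y = do { tick (C x y); return (x / y) }"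

definition num_le :: "real \<Rightarrow> real \<Rightarrow> bool comp" where
  "num_le x y = do { tick (C x y); return (x \<le> y) }"

definition num_less :: "real \<Rightarrow> real \<Rightarrow> bool comp" where
  "num_less x y = do { tick (C x y); return (x < y) }"

text \<open>Insertion sort into descending order of the keys, where elements with equal keys may end up in
  any order.\<close>

fun insert_desc :: "(nat \<Rightarrow> real) \<Rightarrow> nat \<Rightarrow> nat list \<Rightarrow> nat list comp" where
  "insert_desc key j [] = do { tick 1; return [j] }"
| "insert_desc key j (k # ks) = do {
     tick 1;
     before \<leftarrow> num_le (key k) (key j);
     after \<leftarrow> num_le (key j) (key k);
     b \<leftarrow> (if before \<and> after then pick [True, False] else return before);
     if b then return (j # k # ks)
     else do { r \<leftarrow> insert_desc key j ks; return (k # r) } }"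

fun sort_desc :: "(nat \<Rightarrow> real) \<Rightarrow> nat list \<Rightarrow> nat list comp" where
  "sort_desc key [] = do { tick 1; return [] }"
| "sort_desc key (j # js) = do {
     tick 1;
     r \<leftarrow> sort_desc key js;
     insert_desc key j r }"

context
  fixes I :: mdsp
begin

definition disjoint_test :: "nat \<Rightarrow> nat \<Rightarrow> bool comp" where
  "disjoint_test j k = do {
     a \<leftarrow> num_less (t_right I j) (t_left I k);
     b \<leftarrow> num_less (t_right I k) (t_left I j);
     return (a \<or> b) }"

fun count_neighbours :: "nat \<Rightarrow> nat list \<Rightarrow> nat comp" where
  "count_neighbours j [] = do { tick 1; return 0 }"
| "count_neighbours j (k # ks) = do {
     tick 1;
     d \<leftarrow> disjoint_test j k;
     r \<leftarrow> count_neighbours j ks;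
     return (if k \<noteq> j \<and> \<not> d then Suc r else r) }"

fun compute_max_degree :: "nat list \<Rightarrow> nat comp" where
  "compute_max_degree [] = do { tick 1; return 0 }"
| "compute_max_degree (j # js) = do {
     tick 1;
     d \<leftarrow> count_neighbours j [1..<Suc (num_deliveries I)];
     r \<leftarrow> compute_max_degree js;
     return (max d r) }"

fun densities :: "nat list \<Rightarrow> (nat \<Rightarrow> real) comp" where
  "densities [] = do { tick 1; return (\<lambda>_. 0) }"
| "densities (j # js) = do {
     tick 1;
     x \<leftarrow> num_div (profit I j) (cost I j);
     d \<leftarrow> densities js;
     return (d(j := x)) }"

fun disjoint_from_all :: "nat \<Rightarrow> nat list \<Rightarrow> bool comp" where
  "disjoint_from_all j [] = do { tick 1; return True }"
| "disjoint_from_all j (k # ks) = do {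
     tick 1;
     a \<leftarrow> disjoint_test j k;
     b \<leftarrow> disjoint_from_all j ks;
     return (a \<and> b) }"

fun candidate_slots :: "greedy_state \<Rightarrow> nat \<Rightarrow> nat list \<Rightarrow> nat list comp" where
  "candidate_slots s j [] = do { tick 1; return [] }"
| "candidate_slots s j (i # is) = do {
     tick 1;
     b \<leftarrow> disjoint_from_all j (slot_set s i);
     r \<leftarrow> candidate_slots s j is;
     return (if b then i # r else r) }"

definition assign :: "nat \<Rightarrow> greedy_state \<Rightarrow> greedy_state comp" where
  "assign j s = do {
     is \<leftarrow> candidate_slots s j (open_slots s);
     i \<leftarrow> pick is;
     w \<leftarrow> num_add (slot_cost s i) (cost I j);
     p \<leftarrow> num_add (slot_profit s i) (profit I j);
     tick 1;
     let s' = s\<lparr> slot_set := (slot_set s)(i := j # slot_set s i),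
                 slot_cost := (slot_cost s)(i := w),
                 slot_profit := (slot_profit s)(i := p) \<rparr>;
     over \<leftarrow> num_less (budget I) w;
     if over then do {
       tick (length (open_slots s'));
       return (s'\<lparr> open_slots := remove1 i (open_slots s'),
                   closed_slots := i # closed_slots s',
                   last_added := (last_added s')(i := [j]) \<rparr>) }
     else return s' }"

fun assign_loop :: "nat list \<Rightarrow> greedy_state \<Rightarrow> greedy_state comp" where
  "assign_loop [] s = do { tick 1; return s }"
| "assign_loop (j # js) s = do {
     tick (Suc (length (closed_slots s)));
     if length (closed_slots s) = num_drones I then return s
     else do { s' \<leftarrow> assign j s; assign_loop js s' } }"

fun list_total :: "(nat \<Rightarrow> real) \<Rightarrow> nat list \<Rightarrow> real comp" where
  "list_total g [] = do { tick 1; return 0 }"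
| "list_total g (k # ks) = do {
     tick 1;
     r \<leftarrow> list_total g ks;
     num_add (g k) r }"

definition trim_slot :: "nat \<Rightarrow> greedy_state \<Rightarrow> greedy_state comp" where
  "trim_slot i s = do {
     let L = last_added s i;
     tick (length (slot_set s i) * Suc (length L));
     let R = filter (\<lambda>k. k \<notin> set L) (slot_set s i);
     pR \<leftarrow> list_total (profit I) R;
     pL \<leftarrow> list_total (profit I) L;
     keep \<leftarrow> num_le pL pR;
     let T = (if keep then R else L);
     w \<leftarrow> list_total (cost I) T;
     p \<leftarrow> list_total (profit I) T;
     tick 1;
     return (s\<lparr> slot_set := (slot_set s)(i := T),
                slot_cost := (slot_cost s)(i := w),
                slot_profit := (slot_profit s)(i := p) \<rparr>) }"

fun trim_loop :: "nat list \<Rightarrow> greedy_state \<Rightarrow> greedy_state comp" where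
  "trim_loop [] s = do { tick 1; return s }"
| "trim_loop (i # is) s = do { tick 1; s' \<leftarrow> trim_slot i s; trim_loop is s' }"

definition initial_state :: "nat list \<Rightarrow> greedy_state" where
  "initial_state slots = \<lparr> open_slots = slots, closed_slots = [], slot_set = (\<lambda>_. []),
     slot_cost = (\<lambda>_. 0), slot_profit = (\<lambda>_. 0), last_added = (\<lambda>_. []) \<rparr>"

text \<open>The output lists the selected slots together with their sets.\<close>

definition greedy_mdsp :: "(nat \<times> nat list) list comp" where
  "greedy_mdsp = do {
     let js = [1..<Suc (num_deliveries I)];
     tick (length js);
     deg \<leftarrow> compute_max_degree js;
     let slots = [1..<Suc (num_drones I + deg)];
     tick (length slots);
     d \<leftarrow> densities js;
     order \<leftarrow> sort_desc d js;
     s \<leftarrow> assign_loop order (initial_state slots);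
     s' \<leftarrow> trim_loop (closed_slots s) s;
     ranking \<leftarrow> sort_desc (slot_profit s') slots;
     tick (num_drones I);
     return (map (\<lambda>i. (i, slot_set s' i)) (take (num_drones I) ranking)) }"

end

end

definition solution_of :: "(nat \<times> nat list) list \<Rightarrow> nat set list" where
  "solution_of out = map (\<lambda>(i, xs). set xs) out"


section \<open>Running time\<close>

definition unit_charge :: "real \<Rightarrow> real \<Rightarrow> nat" where
  "unit_charge x y = 1"

text \<open>Binary length of a rational number written in lowest terms, with one bit for the sign.\<close>

definition num_bits :: "real \<Rightarrow> nat" where
  "num_bits x = (let (a, b) = quotient_of (THE r. real_of_rat r = x)
                 in 1 + nat (bitlen \<bar>a\<bar>) + nat (bitlen b))"

text \<open>Schoolbook arithmetic, including the reduction to lowest terms by Euclid's algorithm, takes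
  quadratically many bit operations.\<close>

definition bit_charge :: "real \<Rightarrow> real \<Rightarrow> nat" where
  "bit_charge x y = (num_bits x + num_bits y)\<^sup>2"

definition rational_instance :: "mdsp \<Rightarrow> bool" where
  "rational_instance I \<longleftrightarrow> budget I \<in> \<rat> \<and>
     (\<forall>j\<in>deliveries I. t_left I j \<in> \<rat> \<and> t_right I j \<in> \<rat> \<and> cost I j \<in> \<rat> \<and> profit I j \<in> \<rat>)"

text \<open>The drones count with their number rather than with its binary length: the output has one
  entry per drone.\<close>

definition encoding_length :: "mdsp \<Rightarrow> nat" where
  "encoding_length I = num_drones I + num_bits (budget I) +
     (\<Sum>j\<in>deliveries I. num_bits (t_left I j) + num_bits (t_right I j) +
                        num_bits (cost I j) + num_bits (profit I j))"

end

theory Submission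
  imports Defs "HOL-Library.Disjoint_Sets"
begin

text \<open>Let \<open>A\<close> be the set of deliveries that the loop assigns, a prefix of the order by
  density. Either \<open>A\<close> contains all deliveries, or \<open>m\<close> slots are closed and \<open>A\<close> costs more than
  \<open>m * B\<close>. In both cases an exchange argument on densities bounds \<open>f(m)\<close> by the profit of \<open>A\<close>.
  Trimming keeps at least half of the profit of each slot, and the best \<open>m\<close> of the at most
  \<open>2 * m\<close> slots carry at least half of what remains. The loop never gets stuck: while fewer than
  \<open>m\<close> slots are closed, more than \<open>\<Delta>\<close> are open, and the neighbours of a delivery block at most
  \<open>\<Delta>\<close> of them.

  For the bit model it suffices that the arithmetic only meets input numbers, densities and sums of
  costs or profits over sets of deliveries, whose binary lengths are linear in the input length.\<close>

section \<open>Computations with a bounded number of steps\<close>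

text \<open>The charge for an operation depends on the numbers it meets, and ties and slot choices
  are left open, so even a time bound needs the invariants that describe these numbers. Hence time
  and correctness are proved together, once for all runs and for an arbitrary charge
  \<open>C\<close> that is at most \<open>K\<close> on the finite set \<open>numbers I\<close>. The
  three claims are instances with different \<open>K\<close>: a maximum over finitely many pairs of
  numbers, the constant 1, and a polynomial in the encoding length.

  The bound on \<open>f(m)\<close> goes through a relaxation: the union of the sets of a feasible
  solution fits into a single knapsack of capacity \<open>m * B\<close>, and a prefix by density
  that overfills this knapsack is worth at least as much as any set that fits. Overfull slots can be
  repaired at the price of a factor 2, because the overflow is caused by one delivery, which fits on
  its own as its cost is at most \<open>B\<close>. The assumption \<open>m >= \<Delta>\<close>
  enters as \<open>m + \<Delta> <= 2 * m\<close>, which gives the second factor 2 and also keeps the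
  number of slots linear in the input.\<close>

definition run_within :: "nat \<Rightarrow> 'a comp \<Rightarrow> ('a \<Rightarrow> bool) \<Rightarrow> bool" where
  "run_within T c P \<longleftrightarrow> guarantees c (\<lambda>x t. t \<le> T \<and> P x)"

lemma within_return: "P x \<Longrightarrow> run_within 0 (return x) P"
  by (simp add: run_within_def guarantees_def return_def)

lemma within_tick: "run_within t (tick t) (\<lambda>_. True)"
  by (simp add: run_within_def guarantees_def tick_def)

lemma within_pick: "xs \<noteq> [] \<Longrightarrow> run_within (length xs) (pick xs) (\<lambda>x. x \<in> set xs)"
  by (auto simp: run_within_def guarantees_def pick_def)

text \<open>The bound \<open>U\<close> is the same for all intermediate results; whatever makes the
  second computation fast or keeps it from getting stuck has to be carried by
  \<open>P\<close>.\<close>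

lemma within_bind:
  assumes "run_within T c P" and "\<And>x. P x \<Longrightarrow> run_within U (f x) Q"
  shows "run_within (T + U) (bind_comp c f) Q"
proof -
  have c: "outcomes c \<noteq> {}" "\<And>r. r \<in> outcomes c \<Longrightarrow> \<exists>x t. r = Some (x, t) \<and> t \<le> T \<and> P x"
    using assms(1) by (auto simp: run_within_def guarantees_def)
  have f: "outcomes (f x) \<noteq> {}"
    "\<And>r. r \<in> outcomes (f x) \<Longrightarrow> \<exists>y u. r = Some (y, u) \<and> u \<le> U \<and> Q y" if "P x" for x
    using assms(2)[OF that] by (auto simp: run_within_def guarantees_def)
  have "outcomes (bind_comp c f) \<noteq> {}"
    using c f(1) by (fastforce simp: bind_comp_def split: option.splits)
  moreover have "\<exists>y u. r = Some (y, u) \<and> u \<le> T + U \<and> Q y" if r: "r \<in> outcomes (bind_comp c f)" for r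
  proof -
    obtain r' where r': "r' \<in> outcomes c" "r \<in> (case r' of None \<Rightarrow> {None}
        | Some (x, t) \<Rightarrow> map_option (\<lambda>(y, u). (y, t + u)) ` outcomes (f x))"
      using r by (auto simp: bind_comp_def)
    obtain x t where xt: "r' = Some (x, t)" "t \<le> T" "P x" using c(2)[OF r'(1)] by blast
    then obtain r'' where r'': "r'' \<in> outcomes (f x)" "r = map_option (\<lambda>(y, u). (y, t + u)) r''"
      using r'(2) by auto
    then obtain y u where "r'' = Some (y, u)" "u \<le> U" "Q y" using f(2)[OF xt(3)] by blast
    then show ?thesis using r'' xt by simp
  qed
  ultimately show ?thesis by (simp add: run_within_def guarantees_def)
qed

lemma within_mono:
  assumes "run_within T c P" "T \<le> U" "\<And>x. P x \<Longrightarrow> Q x"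
  shows "run_within U c Q"
  using assms unfolding run_within_def guarantees_def by (meson order_trans)

lemma within_bind_return:
  assumes "run_within T c P" "\<And>x. P x \<Longrightarrow> Q (g x)"
  shows "run_within T (bind_comp c (\<lambda>x. return (g x))) Q"
proof -
  have "run_within (T + 0) (bind_comp c (\<lambda>x. return (g x))) Q"
    by (rule within_bind[OF assms(1)], rule within_return, rule assms(2))
  then show ?thesis by simp
qed

lemma within_if:
  "(b \<Longrightarrow> run_within T c P) \<Longrightarrow> (\<not> b \<Longrightarrow> run_within T d P) \<Longrightarrow> run_within T (if b then c else d) P"
  by simp

section \<open>Primitive operations and sorting\<close>

definition charge_bound :: "(real \<Rightarrow> real \<Rightarrow> nat) \<Rightarrow> real set \<Rightarrow> nat \<Rightarrow> bool" where
  "charge_bound C X K \<longleftrightarrow> (\<forall>x\<in>X. \<forall>y\<in>X. C x y \<le> K)"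

lemma within_tick_return: "t \<le> T \<Longrightarrow> run_within T (bind_comp (tick t) (\<lambda>_. return z)) (\<lambda>x. x = z)"
  by (rule within_mono[OF within_bind[OF within_tick within_return[of "\<lambda>x. x = z"]]]) auto

lemma within_num_op:
  assumes "charge_bound C X K" "x \<in> X" "y \<in> X"
  shows "run_within K (num_add C x y) (\<lambda>z. z = x + y)" "run_within K (num_div C x y) (\<lambda>z. z = x / y)"
    "run_within K (num_le C x y) (\<lambda>b. b \<longleftrightarrow> x \<le> y)" "run_within K (num_less C x y) (\<lambda>b. b \<longleftrightarrow> x < y)"
  using assms unfolding num_add_def num_div_def num_le_def num_less_def charge_bound_def
  by (auto intro: within_tick_return)

text \<open>Each element passed costs one tick, two comparisons and at most two steps for choosing
  between two alternatives at a tie, hence \<open>2 * K + 3\<close>.\<close>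

lemma within_insert_desc:
  assumes K: "charge_bound C X K"
  shows "key ` insert j (set ks) \<subseteq> X \<Longrightarrow> sorted_wrt (\<lambda>a b. key b \<le> key a) ks \<Longrightarrow>
    run_within (Suc (length ks) * (2 * K + 3)) (insert_desc C key j ks)
      (\<lambda>r. mset r = mset (j # ks) \<and> sorted_wrt (\<lambda>a b. key b \<le> key a) r)"
proof (induction ks)
  case Nil
  show ?case
    unfolding insert_desc.simps
    by (rule within_mono[OF within_bind_return[OF within_tick]]) auto
next
  case (Cons k ks)
  let ?P = "\<lambda>r. mset r = mset (j # k # ks) \<and> sorted_wrt (\<lambda>a b. key b \<le> key a) r"
  let ?U = "Suc (length ks) * (2 * K + 3)"
  have IH: "run_within ?U (insert_desc C key j ks)
      (\<lambda>r. mset r = mset (j # ks) \<and> sorted_wrt (\<lambda>a b. key b \<le> key a) r)"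
    using Cons by auto
  have X: "key j \<in> X" "key k \<in> X" using Cons.prems by auto
  have yes: "run_within ?U (return (j # k # ks)) ?P" if "key k \<le> key j"
    by (rule within_mono[OF within_return[of ?P]]) (use that Cons.prems in auto)
  have no: "run_within ?U (bind_comp (insert_desc C key j ks) (\<lambda>r. return (k # r))) ?P" if le: "key j \<le> key k"
  proof (rule within_bind_return[OF IH])
    fix r assume r: "mset r = mset (j # ks) \<and> sorted_wrt (\<lambda>a b. key b \<le> key a) r"
    then have "set r = insert j (set ks)" by (metis list.simps(15) mset_eq_setD)
    then show "?P (k # r)" using r le Cons.prems by simp
  qed
  \<comment> \<open>The two alternatives overlap at equal keys, where either one keeps the list
    sorted, so the way a tie is broken is irrelevant.\<close>
  have choice: "run_within 2 (if before \<and> after then pick [True, False] else return before)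
      (\<lambda>b. if b then key k \<le> key j else key j \<le> key k)"
    if "before \<longleftrightarrow> key k \<le> key j" "after \<longleftrightarrow> key j \<le> key k" for before after
  proof (rule within_if)
    assume "before \<and> after"
    then show "run_within 2 (pick [True, False]) (\<lambda>b. if b then key k \<le> key j else key j \<le> key k)"
      using that by (intro within_mono[OF within_pick]) auto
  next
    assume "\<not> (before \<and> after)"
    then show "run_within 2 (return before) (\<lambda>b. if b then key k \<le> key j else key j \<le> key k)"
      using that by (intro within_mono[OF within_return[of "\<lambda>b. b = before"]]) auto
  qed
  have "run_within (1 + (K + (K + (2 + ?U)))) (insert_desc C key j (k # ks)) ?P"
    unfolding insert_desc.simps
    by (intro within_bind[OF within_tick] within_bind[OF within_num_op(3)[OF K X(2,1)]]
        within_bind[OF within_num_op(3)[OF K X(1,2)]] within_bind[OF choice] within_if yes no) auto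
  then show ?case by (rule within_mono) auto
qed

lemma within_sort_desc:
  assumes K: "charge_bound C X K"
  shows "key ` set js \<subseteq> X \<Longrightarrow>
    run_within (Suc (length js) * (1 + Suc (length js) * (2 * K + 3))) (sort_desc C key js)
      (\<lambda>r. mset r = mset js \<and> sorted_wrt (\<lambda>a b. key b \<le> key a) r)"
proof (induction js)
  case Nil
  show ?case
    unfolding sort_desc.simps
    by (rule within_mono[OF within_bind_return[OF within_tick]]) auto
next
  case (Cons j js)
  let ?b = "2 * K + 3"
  have "run_within (1 + (Suc (length js) * (1 + Suc (length js) * ?b) + Suc (length js) * ?b))
      (sort_desc C key (j # js))
      (\<lambda>r. mset r = mset (j # js) \<and> sorted_wrt (\<lambda>a b. key b \<le> key a) r)"
    unfolding sort_desc.simps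
  proof (intro within_bind[OF within_tick] within_bind[OF Cons.IH])
    show "key ` set js \<subseteq> X" using Cons.prems by auto
    fix r assume r: "mset r = mset js \<and> sorted_wrt (\<lambda>a b. key b \<le> key a) r"
    then have "set r = set js" "length r = length js" by (auto dest: mset_eq_setD mset_eq_length)
    then show "run_within (Suc (length js) * ?b) (insert_desc C key j r)
        (\<lambda>r. mset r = mset (j # js) \<and> sorted_wrt (\<lambda>a b. key b \<le> key a) r)"
      using within_mono[OF within_insert_desc[OF K, of key j r]] r Cons.prems by auto
  qed
  then show ?case by (rule within_mono) (auto simp: algebra_simps)
qed

text \<open>All numbers that the algorithm ever passes to an arithmetic operation or comparison.\<close>

definition numbers :: "mdsp \<Rightarrow> real set" where
  "numbers I = {budget I} \<union> t_left I ` deliveries I \<union> t_right I ` deliveries I \<union>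
     (\<lambda>j. profit I j / cost I j) ` deliveries I \<union>
     set_cost I ` Pow (deliveries I) \<union> set_profit I ` Pow (deliveries I)"

lemma finite_deliveries [simp]: "finite (deliveries I)"
  by (simp add: deliveries_def)

lemma finite_subset_deliveries: "S \<subseteq> deliveries I \<Longrightarrow> finite S"
  by (rule finite_subset[OF _ finite_deliveries])

lemma length_le_num_deliveries:
  assumes "distinct xs" "set xs \<subseteq> deliveries I"
  shows "length xs \<le> num_deliveries I"
  using card_mono[OF finite_deliveries assms(2)] distinct_card[OF assms(1)]
  by (simp add: deliveries_def)

lemma finite_numbers: "finite (numbers I)"
  by (simp add: numbers_def)

lemma numbersI:
  "budget I \<in> numbers I"
  "j \<in> deliveries I \<Longrightarrow> t_left I j \<in> numbers I"
  "j \<in> deliveries I \<Longrightarrow> t_right I j \<in> numbers I"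
  "j \<in> deliveries I \<Longrightarrow> profit I j / cost I j \<in> numbers I"
  "S \<subseteq> deliveries I \<Longrightarrow> set_cost I S \<in> numbers I"
  "S \<subseteq> deliveries I \<Longrightarrow> set_profit I S \<in> numbers I"
  by (auto simp: numbers_def)

lemma cost_in_numbers: "j \<in> deliveries I \<Longrightarrow> cost I j \<in> numbers I"
  and profit_in_numbers: "j \<in> deliveries I \<Longrightarrow> profit I j \<in> numbers I"
  using numbersI(5)[of "{j}" I] numbersI(6)[of "{j}" I] by (simp_all add: set_cost_def set_profit_def)

text \<open>The algorithm sees endpoints only; since the intervals of an instance are nonempty, two
  strict comparisons decide whether they meet.\<close>

lemma interval_disjoint_iff:
  assumes "mdsp_instance I" "j \<in> deliveries I" "k \<in> deliveries I"
  shows "interval I j \<inter> interval I k = {} \<longleftrightarrow> t_right I j < t_left I k \<or> t_right I k < t_left I j"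
proof -
  have "t_left I j \<le> t_right I j" "t_left I k \<le> t_right I k"
    using assms by (auto simp: mdsp_instance_def)
  then show ?thesis by (auto simp: interval_def max_def min_def)
qed

section \<open>Step bounds of the subroutines\<close>

context
  fixes I :: mdsp and C :: "real \<Rightarrow> real \<Rightarrow> nat" and K :: nat
  assumes inst: "mdsp_instance I" and K: "charge_bound C (numbers I) K"
begin

lemma within_disjoint_test:
  assumes "j \<in> deliveries I" "k \<in> deliveries I"
  shows "run_within (2 * K) (disjoint_test C I j k) (\<lambda>b. b \<longleftrightarrow> interval I j \<inter> interval I k = {})"
proof -
  have "run_within (K + (K + 0)) (disjoint_test C I j k) (\<lambda>b. b \<longleftrightarrow> interval I j \<inter> interval I k = {})"
    unfolding disjoint_test_def interval_disjoint_iff[OF inst assms]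
    by (intro within_bind[OF within_num_op(4)[OF K]] within_return) (auto intro: numbersI assms)
  then show ?thesis by (simp add: mult_2)
qed

lemma within_count_neighbours:
  "distinct ks \<Longrightarrow> j \<in> deliveries I \<Longrightarrow> set ks \<subseteq> deliveries I \<Longrightarrow>
   run_within (Suc (length ks) * (1 + 2 * K)) (count_neighbours C I j ks)
     (\<lambda>r. r = card {k \<in> set ks. k \<noteq> j \<and> interval I j \<inter> interval I k \<noteq> {}})"
proof (induction ks)
  case Nil
  show ?case
    unfolding count_neighbours.simps
    by (rule within_mono[OF within_bind_return[OF within_tick]]) auto
next
  case (Cons k ks)
  let ?S = "\<lambda>ks. {k \<in> set ks. k \<noteq> j \<and> interval I j \<inter> interval I k \<noteq> {}}"
  have S: "?S (k # ks) = (if k \<noteq> j \<and> interval I j \<inter> interval I k \<noteq> {} then insert k (?S ks) else ?S ks)"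
    "k \<notin> ?S ks" "finite (?S ks)"
    using Cons.prems(1) by auto
  have "run_within (1 + (2 * K + (Suc (length ks) * (1 + 2 * K) + 0))) (count_neighbours C I j (k # ks))
      (\<lambda>r. r = card (?S (k # ks)))"
    unfolding count_neighbours.simps S(1)
    using S(2,3) Cons.prems
    by (intro within_bind[OF within_tick] within_bind[OF within_disjoint_test]
        within_bind[OF Cons.IH] within_return) auto
  then show ?case by (rule within_mono) auto
qed

lemma within_compute_max_degree:
  "set js \<subseteq> deliveries I \<Longrightarrow>
   run_within (Suc (length js) * (1 + Suc (num_deliveries I) * (1 + 2 * K))) (compute_max_degree C I js)
     (\<lambda>r. r = Max (insert 0 ((\<lambda>j. card (neighbours I j)) ` set js)))"
proof (induction js)
  case Nil
  show ?case
    unfolding compute_max_degree.simps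
    by (rule within_mono[OF within_bind_return[OF within_tick]]) auto
next
  case (Cons j js)
  let ?js = "[1..<Suc (num_deliveries I)]"
  let ?U = "Suc (length js) * (1 + Suc (num_deliveries I) * (1 + 2 * K))"
  have js: "set ?js = deliveries I" by (auto simp: deliveries_def)
  have count: "run_within (Suc (length ?js) * (1 + 2 * K)) (count_neighbours C I j ?js)
     (\<lambda>r. r = card (neighbours I j))"
    using within_count_neighbours[of ?js j] Cons.prems unfolding js neighbours_def
    by (simp del: upt_Suc)
  \<comment> \<open>The inserted \<open>0\<close> keeps the inner set nonempty, so
    \<open>Max_insert\<close> applies even when no deliveries are left; it matches the result 0 of
    the recursion on the empty list.\<close>
  have Max: "max d (Max (insert 0 M)) = Max (insert 0 (insert d M))" if "finite M" for d and M :: "nat set"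
  proof -
    have "Max (insert 0 (insert d M)) = Max (insert d (insert 0 M))" by (simp add: insert_commute)
    also have "\<dots> = max d (Max (insert 0 M))" using that by (subst Max_insert) auto
    finally show ?thesis by simp
  qed
  have "run_within (1 + (Suc (length ?js) * (1 + 2 * K) + (?U + 0))) (compute_max_degree C I (j # js))
     (\<lambda>r. r = Max (insert 0 ((\<lambda>j. card (neighbours I j)) ` set (j # js))))"
    unfolding compute_max_degree.simps
    using Cons.prems
    by (intro within_bind[OF within_tick] within_bind[OF count] within_bind[OF Cons.IH] within_return)
      (auto simp: Max)
  then show ?case by (rule within_mono) auto
qed

lemma within_densities:
  "set js \<subseteq> deliveries I \<Longrightarrow>
   run_within (Suc (length js) * (1 + K)) (densities C I js)
     (\<lambda>d. \<forall>j\<in>set js. d j = profit I j / cost I j)"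
proof (induction js)
  case Nil
  show ?case
    unfolding densities.simps
    by (rule within_mono[OF within_bind_return[OF within_tick]]) auto
next
  case (Cons j js)
  then have j: "j \<in> deliveries I" by auto
  have "run_within (1 + (K + (Suc (length js) * (1 + K) + 0))) (densities C I (j # js))
     (\<lambda>d. \<forall>j\<in>set (j # js). d j = profit I j / cost I j)"
    unfolding densities.simps
    using Cons.prems
    by (intro within_bind[OF within_tick] within_bind[OF Cons.IH] within_return
        within_bind[OF within_num_op(2)[OF K profit_in_numbers[OF j] cost_in_numbers[OF j]]]) auto
  then show ?case by (rule within_mono) auto
qed

lemma within_disjoint_from_all:
  "j \<in> deliveries I \<Longrightarrow> set ks \<subseteq> deliveries I \<Longrightarrow>
   run_within (Suc (length ks) * (1 + 2 * K)) (disjoint_from_all C I j ks)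
     (\<lambda>b. b \<longleftrightarrow> (\<forall>k\<in>set ks. interval I j \<inter> interval I k = {}))"
proof (induction ks)
  case Nil
  show ?case
    unfolding disjoint_from_all.simps
    by (rule within_mono[OF within_bind_return[OF within_tick]]) auto
next
  case (Cons k ks)
  have "run_within (1 + (2 * K + (Suc (length ks) * (1 + 2 * K) + 0))) (disjoint_from_all C I j (k # ks))
      (\<lambda>b. b \<longleftrightarrow> (\<forall>k\<in>set (k # ks). interval I j \<inter> interval I k = {}))"
    unfolding disjoint_from_all.simps
    using Cons.prems
    by (intro within_bind[OF within_tick] within_bind[OF within_disjoint_test]
        within_bind[OF Cons.IH] within_return) auto
  then show ?case by (rule within_mono) auto
qed

text \<open>A slot's list is distinct, so it is no longer than the number of deliveries, which makes
  the cost per slot uniform. The result is determined exactly, so that its nonemptiness can be shown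
  separately from the invariant.\<close>

lemma within_candidate_slots:
  "j \<in> deliveries I \<Longrightarrow>
   (\<And>i. i \<in> set is \<Longrightarrow> distinct (slot_set s i) \<and> set (slot_set s i) \<subseteq> deliveries I) \<Longrightarrow>
   run_within (Suc (length is) * (1 + Suc (num_deliveries I) * (1 + 2 * K))) (candidate_slots C I s j is)
     (\<lambda>r. r = filter (\<lambda>i. \<forall>k\<in>set (slot_set s i). interval I j \<inter> interval I k = {}) is)"
proof (induction "is")
  case Nil
  show ?case
    unfolding candidate_slots.simps
    by (rule within_mono[OF within_bind_return[OF within_tick]]) auto
next
  case (Cons i "is")
  let ?U = "Suc (num_deliveries I) * (1 + 2 * K)"
  have i: "distinct (slot_set s i)" "set (slot_set s i) \<subseteq> deliveries I" using Cons.prems(2) by auto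
  have "Suc (length (slot_set s i)) * (1 + 2 * K) \<le> ?U"
    by (intro mult_le_mono1) (use length_le_num_deliveries[OF i] in simp)
  then have test: "run_within ?U (disjoint_from_all C I j (slot_set s i))
      (\<lambda>b. b \<longleftrightarrow> (\<forall>k\<in>set (slot_set s i). interval I j \<inter> interval I k = {}))"
    by (rule within_mono[OF within_disjoint_from_all[OF Cons.prems(1) i(2)]])
  have "run_within (1 + (?U + (Suc (length is) * (1 + ?U) + 0))) (candidate_slots C I s j (i # is))
     (\<lambda>r. r = filter (\<lambda>i. \<forall>k\<in>set (slot_set s i). interval I j \<inter> interval I k = {}) (i # is))"
    unfolding candidate_slots.simps
    using Cons.prems
    by (intro within_bind[OF within_tick] within_bind[OF test] within_bind[OF Cons.IH] within_return) auto
  then show ?case by (rule within_mono) auto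
qed

text \<open>The operands are single values and sums over suffixes of the list. By distinctness these
  are sums over sets of deliveries, so one closure condition on \<open>g\<close> covers both costs
  and profits.\<close>

lemma within_list_total:
  assumes g: "\<And>S. S \<subseteq> deliveries I \<Longrightarrow> sum g S \<in> numbers I"
    and ks: "distinct ks" "set ks \<subseteq> deliveries I"
  shows "run_within (Suc (num_deliveries I) * (1 + K)) (list_total C g ks) (\<lambda>r. r = sum g (set ks))"
proof -
  have "run_within (Suc (length ks) * (1 + K)) (list_total C g ks) (\<lambda>r. r = sum g (set ks))"
    if "distinct ks" "set ks \<subseteq> deliveries I" for ks
    using that
  proof (induction ks)
    case Nil
    show ?case
      unfolding list_total.simps
      by (rule within_mono[OF within_bind_return[OF within_tick]]) auto
  next
    case (Cons k ks)
    have N: "g k \<in> numbers I" "sum g (set ks) \<in> numbers I"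
      using g[of "{k}"] g[of "set ks"] Cons.prems by auto
    have "run_within (1 + (Suc (length ks) * (1 + K) + K)) (list_total C g (k # ks))
        (\<lambda>r. r = sum g (set (k # ks)))"
      unfolding list_total.simps
      using Cons.prems
      by (intro within_bind[OF within_tick] within_bind[OF Cons.IH])
        (auto intro: within_num_op(1)[OF K N])
    then show ?case by (rule within_mono) auto
  qed
  then have "run_within (Suc (length ks) * (1 + K)) (list_total C g ks) (\<lambda>r. r = sum g (set ks))"
    using ks .
  moreover have "Suc (length ks) * (1 + K) \<le> Suc (num_deliveries I) * (1 + K)"
    by (intro mult_le_mono1) (use length_le_num_deliveries[OF ks] in simp)
  ultimately show ?thesis by (rule within_mono)
qed

end

section \<open>The approximation ratio\<close>

text \<open>\<open>A\<close> collects the deliveries assigned so far. The last clause splits a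
  closed slot into the delivery that overfilled it and a rest that fits, the two parts between which
  trimming chooses; its final inequality is what makes the closed slots together exceed the budget
  of a feasible solution.\<close>

definition greedy_invariant :: "mdsp \<Rightarrow> nat set \<Rightarrow> nat set \<Rightarrow> greedy_state \<Rightarrow> bool" where
  "greedy_invariant I slots A s \<longleftrightarrow>
     distinct (open_slots s @ closed_slots s) \<and> set (open_slots s @ closed_slots s) = slots \<and>
     (\<Union>i\<in>slots. set (slot_set s i)) = A \<and>
     disjoint_family_on (\<lambda>i. set (slot_set s i)) slots \<and>
     (\<forall>i\<in>slots. distinct (slot_set s i) \<and> compatible I (set (slot_set s i)) \<and>
        slot_cost s i = set_cost I (set (slot_set s i)) \<and>
        slot_profit s i = set_profit I (set (slot_set s i))) \<and>
     (\<forall>i\<in>set (open_slots s). slot_cost s i \<le> budget I) \<and>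
     (\<forall>i\<in>set (closed_slots s). \<exists>j xs. slot_set s i = j # xs \<and> last_added s i = [j] \<and>
        set_cost I (set xs) \<le> budget I \<and> budget I < slot_cost s i)"

lemma greedy_invariantD:
  assumes "greedy_invariant I slots A s"
  shows "distinct (open_slots s @ closed_slots s)" "set (open_slots s) \<union> set (closed_slots s) = slots"
    "set (open_slots s) \<subseteq> slots" "set (closed_slots s) \<subseteq> slots"
    "(\<Union>i\<in>slots. set (slot_set s i)) = A" "disjoint_family_on (\<lambda>i. set (slot_set s i)) slots"
    "i \<in> slots \<Longrightarrow> set (slot_set s i) \<subseteq> A"
    "i \<in> slots \<Longrightarrow> distinct (slot_set s i)" "i \<in> slots \<Longrightarrow> compatible I (set (slot_set s i))"
    "i \<in> slots \<Longrightarrow> slot_cost s i = set_cost I (set (slot_set s i))"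
    "i \<in> slots \<Longrightarrow> slot_profit s i = set_profit I (set (slot_set s i))"
    "i \<in> set (open_slots s) \<Longrightarrow> slot_cost s i \<le> budget I"
    "i \<in> set (closed_slots s) \<Longrightarrow> \<exists>j xs. slot_set s i = j # xs \<and> last_added s i = [j] \<and>
        set_cost I (set xs) \<le> budget I \<and> budget I < slot_cost s i"
    "length (open_slots s) + length (closed_slots s) = card slots"
  using assms distinct_card[of "open_slots s @ closed_slots s"] unfolding greedy_invariant_def by auto

lemma greedy_invariant_initial:
  assumes "distinct slots" "0 \<le> budget I"
  shows "greedy_invariant I (set slots) {} (initial_state slots)"
  using assms by (simp add: greedy_invariant_def initial_state_def disjoint_family_on_def
      compatible_def set_cost_def set_profit_def)

text \<open>The two conclusions are the two branches after the update of a slot: it stays open, or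
  it is closed because of \<open>j\<close>.\<close>

lemma greedy_invariant_add:
  assumes inv: "greedy_invariant I slots A s" and i: "i \<in> set (open_slots s)" and j: "j \<notin> A"
    and disj: "\<forall>k\<in>set (slot_set s i). interval I j \<inter> interval I k = {}"
    and s': "s' = s\<lparr> slot_set := (slot_set s)(i := j # slot_set s i),
                 slot_cost := (slot_cost s)(i := slot_cost s i + cost I j),
                 slot_profit := (slot_profit s)(i := slot_profit s i + profit I j) \<rparr>"
  shows "slot_cost s' i \<le> budget I \<Longrightarrow> greedy_invariant I slots (insert j A) s'"
    and "budget I < slot_cost s' i \<Longrightarrow> greedy_invariant I slots (insert j A)
      (s'\<lparr> open_slots := remove1 i (open_slots s'), closed_slots := i # closed_slots s',
           last_added := (last_added s')(i := [j]) \<rparr>)"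
proof -
  note D = greedy_invariantD[OF inv]
  have i': "i \<in> slots" "i \<notin> set (closed_slots s)" "distinct (open_slots s)"
    using D(1,3) i by auto
  have A: "set (slot_set s k) \<subseteq> A" if "k \<in> slots" for k using D(7)[OF that] .
  have j': "j \<notin> set (slot_set s k)" if "k \<in> slots" for k using A[OF that] j by auto
  have union: "(\<Union>k\<in>slots. set (slot_set s' k)) = insert j A"
    unfolding s' using D(5) i' by (auto split: if_splits)
  have disjoint: "disjoint_family_on (\<lambda>k. set (slot_set s' k)) slots"
    using D(6) j' unfolding s' disjoint_family_on_def by auto
  have slot: "distinct (slot_set s' k) \<and> compatible I (set (slot_set s' k)) \<and>
        slot_cost s' k = set_cost I (set (slot_set s' k)) \<and>
        slot_profit s' k = set_profit I (set (slot_set s' k))" if "k \<in> slots" for k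
  proof (cases "k = i")
    case True
    have "compatible I (insert j (set (slot_set s i)))"
      using D(9)[OF i'(1)] disj unfolding compatible_def pairwise_insert by (auto simp: Int_commute)
    then show ?thesis
      using D(8,10,11)[OF i'(1)] j'[OF i'(1)] by (simp add: True s' set_cost_def set_profit_def)
  next
    case False
    then show ?thesis using D(8-11)[OF that] by (simp add: s')
  qed
  show "greedy_invariant I slots (insert j A) s'" if "slot_cost s' i \<le> budget I"
    unfolding greedy_invariant_def
  proof (intro conjI ballI)
    fix k assume "k \<in> set (closed_slots s')"
    then have "k \<in> set (closed_slots s)" "k \<noteq> i" using i' by (auto simp: s')
    then show "\<exists>j xs. slot_set s' k = j # xs \<and> last_added s' k = [j] \<and>
        set_cost I (set xs) \<le> budget I \<and> budget I < slot_cost s' k"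
      using D(13)[of k] by (simp add: s')
  qed (use D(1-4) D(12) that slot union disjoint in \<open>auto simp: s'\<close>)
  let ?s = "s'\<lparr> open_slots := remove1 i (open_slots s'), closed_slots := i # closed_slots s',
           last_added := (last_added s')(i := [j]) \<rparr>"
  show "greedy_invariant I slots (insert j A) ?s" if "budget I < slot_cost s' i"
    unfolding greedy_invariant_def
  proof (intro conjI ballI)
    fix k assume k: "k \<in> set (closed_slots ?s)"
    show "\<exists>j xs. slot_set ?s k = j # xs \<and> last_added ?s k = [j] \<and>
        set_cost I (set xs) \<le> budget I \<and> budget I < slot_cost ?s k"
    proof (cases "k = i")
      case True
      \<comment> \<open>Slot \<open>i\<close> was open before, so its old set fits the budget and
        serves as \<open>xs\<close>.\<close>
      then show ?thesis using that D(12)[OF i] D(10)[OF i'(1)] by (simp add: s')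
    next
      case False
      then show ?thesis using k D(13)[of k] by (simp add: s')
    qed
  qed (use D(1-4) D(12) i i' slot union disjoint in \<open>auto simp: s'\<close>)
qed

section \<open>Existence of a slot for every delivery\<close>

lemma card_neighbours_le_max_degree:
  "j \<in> deliveries I \<Longrightarrow> card (neighbours I j) \<le> max_degree I"
  unfolding max_degree_def by (intro Max_ge) auto

text \<open>Every open slot that cannot take \<open>j\<close> contains a neighbour of \<open>j\<close>, and these neighbours are
  distinct.\<close>

lemma ex_open_slot:
  assumes inv: "greedy_invariant I slots A s" and A: "A \<subseteq> deliveries I"
    and j: "j \<in> deliveries I" "j \<notin> A" and many: "max_degree I < length (open_slots s)"
  shows "\<exists>i\<in>set (open_slots s). \<forall>k\<in>set (slot_set s i). interval I j \<inter> interval I k = {}"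
proof (rule ccontr)
  assume "\<not> ?thesis"
  then obtain b where b: "\<forall>i\<in>set (open_slots s). b i \<in> set (slot_set s i) \<and> interval I j \<inter> interval I (b i) \<noteq> {}"
    by metis
  note D = greedy_invariantD[OF inv]
  have "inj_on b (set (open_slots s))"
  proof (rule inj_onI)
    fix i i' assume i: "i \<in> set (open_slots s)" "i' \<in> set (open_slots s)" "b i = b i'"
    then have "b i \<in> set (slot_set s i) \<inter> set (slot_set s i')" using b by auto
    then show "i = i'" using i D(3) D(6) unfolding disjoint_family_on_def by (metis empty_iff subsetD)
  qed
  moreover have "b ` set (open_slots s) \<subseteq> neighbours I j"
  proof -
    \<comment> \<open>Membership in \<open>A\<close> also separates \<open>b i\<close> from
      \<open>j\<close>, whose interval may meet itself.\<close>
    have "b i \<in> A" if "i \<in> set (open_slots s)" for i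
      using D(3) D(7)[of i] b that by blast
    then show ?thesis using A b j by (auto simp: neighbours_def)
  qed
  moreover have "finite (neighbours I j)" by (simp add: neighbours_def)
  ultimately have "card (set (open_slots s)) \<le> card (neighbours I j)"
    by (rule card_inj_on_le)
  moreover have "card (set (open_slots s)) = length (open_slots s)"
    using D(1) by (auto intro: distinct_card)
  ultimately show False using card_neighbours_le_max_degree[OF j(1)] many by simp
qed

section \<open>Exchange argument and the upper bound on the optimum\<close>

lemma set_profit_le_densest:
  assumes "finite A" "finite U"
    and c: "\<And>j. j \<in> A \<union> U \<Longrightarrow> 0 < cost I j" and p: "\<And>j. j \<in> A \<union> U \<Longrightarrow> 0 \<le> profit I j"
    and dense: "\<And>a b. a \<in> A \<Longrightarrow> b \<in> U - A \<Longrightarrow> profit I b / cost I b \<le> profit I a / cost I a"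
    and cost: "U \<subseteq> A \<or> set_cost I U \<le> set_cost I A"
  shows "set_profit I U \<le> set_profit I A"
proof (cases "U \<subseteq> A")
  case True
  then show ?thesis unfolding set_profit_def using assms by (intro sum_mono2) auto
next
  case False
  \<comment> \<open>The best density in \<open>U - A\<close> is a threshold: elements of
    \<open>U - A\<close> lie at or below it, elements of \<open>A - U\<close> at or above it. As
    \<open>U - A\<close> costs no more than \<open>A - U\<close>, pricing both differences at
    \<open>d\<close> shows that exchanging one for the other loses no profit.\<close>
  define d where "d = Max ((\<lambda>b. profit I b / cost I b) ` (U - A))"
  have fin: "finite (U - A)" "U - A \<noteq> {}" using False assms(2) by auto
  have "d \<in> (\<lambda>b. profit I b / cost I b) ` (U - A)"
    unfolding d_def using fin by (intro Max_in) auto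
  then obtain b0 where b0: "b0 \<in> U - A" "d = profit I b0 / cost I b0" by auto
  have d0: "0 \<le> d" using b0 c[of b0] p[of b0] by auto
  have out: "profit I b \<le> d * cost I b" if "b \<in> U - A" for b
  proof -
    have "profit I b / cost I b \<le> d" unfolding d_def using fin that by (intro Max_ge) auto
    then show ?thesis using c[of b] that by (simp add: divide_simps)
  qed
  have inn: "d * cost I a \<le> profit I a" if "a \<in> A - U" for a
  proof -
    have "d \<le> profit I a / cost I a" using dense[of a b0] b0 that by simp
    then show ?thesis using c[of a] that by (simp add: pos_le_divide_eq)
  qed
  have split: "sum g U = sum g (U - A) + sum g (U \<inter> A)" "sum g A = sum g (A - U) + sum g (U \<inter> A)"
    for g :: "nat \<Rightarrow> real"
    using assms(1,2) by (metis sum.Int_Diff add.commute, metis sum.Int_Diff add.commute Int_commute)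
  have "set_cost I (U - A) \<le> set_cost I (A - U)"
    using cost False unfolding set_cost_def split by simp
  then have "d * set_cost I (U - A) \<le> d * set_cost I (A - U)"
    using d0 by (rule mult_left_mono)
  moreover have "set_profit I (U - A) \<le> d * set_cost I (U - A)"
    unfolding set_profit_def set_cost_def sum_distrib_left by (rule sum_mono) (rule out)
  moreover have "d * set_cost I (A - U) \<le> set_profit I (A - U)"
    unfolding set_profit_def set_cost_def sum_distrib_left by (rule sum_mono) (rule inn)
  ultimately show ?thesis unfolding set_profit_def split by simp
qed

lemma feasible_solution_disjoint:
  "feasible_solution I m Ss \<Longrightarrow> disjoint_family_on (\<lambda>i. Ss ! i) {..<m}"
  by (auto simp: feasible_solution_def disjoint_family_on_def)

text \<open>This is the relaxation to one knapsack of capacity \<open>m * B\<close>: the upper bound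
  looks at a solution only through its union.\<close>

lemma feasible_solution_union:
  assumes "feasible_solution I m Ss"
  shows "(\<Union>i<m. Ss ! i) \<subseteq> deliveries I"
    "total_profit I Ss = set_profit I (\<Union>i<m. Ss ! i)"
    "set_cost I (\<Union>i<m. Ss ! i) \<le> real m * budget I"
proof -
  have len: "length Ss = m" and feas: "\<And>i. i < m \<Longrightarrow> feasible_set I (Ss ! i)"
    using assms by (auto simp: feasible_solution_def)
  have sub: "Ss ! i \<subseteq> deliveries I" if "i < m" for i
    using feas[OF that] by (auto simp: feasible_set_def)
  have fin: "finite (Ss ! i)" if "i < m" for i
    using sub[OF that] by (rule finite_subset_deliveries)
  show "(\<Union>i<m. Ss ! i) \<subseteq> deliveries I" using sub by auto
  have sum_union: "sum g (\<Union>i<m. Ss ! i) = (\<Sum>i<m. sum g (Ss ! i))" for g :: "nat \<Rightarrow> real"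
    by (rule sum.UNION_disjoint_family) (use fin feasible_solution_disjoint[OF assms] in auto)
  show "total_profit I Ss = set_profit I (\<Union>i<m. Ss ! i)"
    unfolding set_profit_def sum_union
    by (simp add: total_profit_def set_profit_def sum_list_sum_nth len atLeast0LessThan)
  have "set_cost I (\<Union>i<m. Ss ! i) \<le> (\<Sum>i<m. budget I)"
    unfolding set_cost_def sum_union
    by (rule sum_mono) (use feas in \<open>auto simp: feasible_set_def set_cost_def\<close>)
  then show "set_cost I (\<Union>i<m. Ss ! i) \<le> real m * budget I" by simp
qed

text \<open>\<open>Max\<close> is meaningful here because there are finitely many solutions and at
  least one, the family of \<open>m\<close> empty sets, which fits as the budget is
  nonnegative.\<close>

lemma opt_profit_le:
  assumes "0 \<le> budget I" and "\<And>Ss. feasible_solution I m Ss \<Longrightarrow> total_profit I Ss \<le> b"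
  shows "opt_profit I m \<le> b"
proof -
  have "{Ss. feasible_solution I m Ss} \<subseteq> {Ss. set Ss \<subseteq> Pow (deliveries I) \<and> length Ss = m}"
    by (auto simp: feasible_solution_def feasible_set_def)
  moreover have "finite {Ss. set Ss \<subseteq> Pow (deliveries I) \<and> length Ss = m}"
    by (rule finite_lists_length_eq) simp
  ultimately have "finite {Ss. feasible_solution I m Ss}" by (rule finite_subset)
  moreover have "feasible_solution I m (replicate m {})"
    using assms(1) by (auto simp: feasible_solution_def feasible_set_def compatible_def set_cost_def)
  ultimately show ?thesis
    unfolding opt_profit_def using assms(2)
    by (subst Max_le_iff) (auto simp: setcompr_eq_image)
qed

text \<open>If \<open>m\<close> slots are closed, the assigned deliveries cost more than the whole budget \<open>m * B\<close>
  of any feasible solution.\<close>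

lemma opt_profit_le_assigned:
  assumes inst: "mdsp_instance I" and inv: "greedy_invariant I slots A s" and A: "A \<subseteq> deliveries I"
    and dense: "\<And>a b. a \<in> A \<Longrightarrow> b \<in> deliveries I - A \<Longrightarrow> profit I b / cost I b \<le> profit I a / cost I a"
    and stop: "A = deliveries I \<or> length (closed_slots s) = m"
  shows "opt_profit I m \<le> (\<Sum>i\<in>slots. set_profit I (set (slot_set s i)))"
proof -
  note D = greedy_invariantD[OF inv]
  have B: "0 \<le> budget I" and c: "\<And>j. j \<in> deliveries I \<Longrightarrow> 0 < cost I j"
    and p: "\<And>j. j \<in> deliveries I \<Longrightarrow> 0 \<le> profit I j"
    using inst by (auto simp: mdsp_instance_def)
  have fin: "finite slots" "finite A" using D(2) finite_subset_deliveries[OF A] by auto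
  \<comment> \<open>The slots partition \<open>A\<close>, so costs and profits of \<open>A\<close>
    split into contributions of slots.\<close>
  have sum_A: "sum g A = (\<Sum>i\<in>slots. sum g (set (slot_set s i)))" for g :: "nat \<Rightarrow> real"
    unfolding D(5)[symmetric] by (rule sum.UNION_disjoint_family) (use fin D(6) in auto)
  have cost: "real (length (closed_slots s)) * budget I \<le> set_cost I A"
  proof -
    have "real (length (closed_slots s)) * budget I = (\<Sum>i\<in>set (closed_slots s). budget I)"
      using D(1) by (simp add: distinct_card)
    also have "\<dots> \<le> (\<Sum>i\<in>set (closed_slots s). set_cost I (set (slot_set s i)))"
      by (rule sum_mono) (use D(4) D(10) D(13) in force)
    also have "\<dots> \<le> (\<Sum>i\<in>slots. set_cost I (set (slot_set s i)))"
    proof (rule sum_mono2[OF fin(1) D(4)])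
      fix i assume "i \<in> slots - set (closed_slots s)"
      then have "set (slot_set s i) \<subseteq> deliveries I" using D(7)[of i] A by auto
      then show "0 \<le> set_cost I (set (slot_set s i))"
        unfolding set_cost_def by (intro sum_nonneg) (use c in force)
    qed
    also have "\<dots> = set_cost I A" by (simp add: set_cost_def sum_A)
    finally show ?thesis .
  qed
  have "opt_profit I m \<le> set_profit I A"
  proof (rule opt_profit_le[OF B])
    fix Ss assume feas: "feasible_solution I m Ss"
    let ?U = "\<Union>i<m. Ss ! i"
    note U = feasible_solution_union[OF feas]
    have "set_profit I ?U \<le> set_profit I A"
    proof (rule set_profit_le_densest[OF fin(2)])
      show "finite ?U" using U(1) by (rule finite_subset_deliveries)
      \<comment> \<open>The two reasons for the loop to end correspond to the two cases of the
        exchange argument: nothing is left outside \<open>A\<close>, or \<open>A\<close> costs at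
        least \<open>m * B\<close>.\<close>
      show "?U \<subseteq> A \<or> set_cost I ?U \<le> set_cost I A"
        using stop
      proof
        assume "length (closed_slots s) = m"
        then show ?thesis using U(3) cost by simp
      qed (use U(1) in simp)
    qed (use A U(1) c p dense in auto)
    then show "total_profit I Ss \<le> set_profit I A" using U(2) by simp
  qed
  then show ?thesis by (simp add: set_profit_def sum_A)
qed

section \<open>Trimming and selecting slots\<close>

lemma sum_list_take_ge_half:
  fixes xs :: "real list"
  assumes "sorted_wrt (\<ge>) xs" "m \<le> length xs" "length xs \<le> 2 * m" "\<And>x. x \<in> set xs \<Longrightarrow> 0 \<le> x"
  shows "sum_list xs \<le> 2 * sum_list (take m xs)"
proof (cases "m = 0")
  case True
  then show ?thesis using assms by simp
next
  case False
  \<comment> \<open>The smallest selected entry is a pivot: at most \<open>m\<close> entries follow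
    the selection, none above it, and the \<open>m\<close> selected ones are none below it. The case
    \<open>m = 0\<close> is separate because this index does not exist then.\<close>
  let ?x = "xs ! (m - 1)"
  have x: "0 \<le> ?x" using assms False by auto
  have nth: "xs ! b \<le> xs ! a" if "a \<le> b" "b < length xs" for a b
    using assms(1) that by (cases "a = b") (auto simp: sorted_wrt_iff_nth_less)
  have "sum_list (drop m xs) = (\<Sum>i<length xs - m. xs ! (m + i))"
    by (simp add: sum_list_sum_nth atLeast0LessThan)
  also have "\<dots> \<le> (\<Sum>i<length xs - m. ?x)" by (rule sum_mono, rule nth) auto
  also have "\<dots> = real (length xs - m) * ?x" by simp
  also have "\<dots> \<le> real m * ?x" using x assms(3) by (intro mult_right_mono) auto
  also have "\<dots> = (\<Sum>i<m. ?x)" by simp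
  also have "\<dots> \<le> (\<Sum>i<m. xs ! i)" using assms(2) by (intro sum_mono nth) auto
  also have "\<dots> = sum_list (take m xs)"
    using assms(2) by (simp add: sum_list_sum_nth atLeast0LessThan min_def)
  finally show ?thesis
    using sum_list_append[of "take m xs" "drop m xs"] by simp
qed

text \<open>What selection needs to know about one slot, closed or open. The subset condition lets
  disjointness survive trimming; \<open>p\<close> stands for the stored profit by which slots are
  ranked.\<close>

definition trimmed :: "mdsp \<Rightarrow> nat list \<Rightarrow> nat list \<Rightarrow> real \<Rightarrow> bool" where
  "trimmed I xs ys p \<longleftrightarrow> set ys \<subseteq> set xs \<and> feasible_set I (set ys) \<and>
     p = set_profit I (set ys) \<and> set_profit I (set xs) \<le> 2 * p"

lemma compatible_subset: "compatible I S \<Longrightarrow> T \<subseteq> S \<Longrightarrow> compatible I T"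
  unfolding compatible_def by (rule pairwise_subset)

text \<open>The rest fits by the invariant and \<open>{j}\<close> fits because no single cost
  exceeds the budget; the more profitable of two parts carries at least half of the total.\<close>

lemma trimmed_closed_slot:
  assumes inst: "mdsp_instance I" and xs: "distinct (j # xs)" "set (j # xs) \<subseteq> deliveries I"
    "compatible I (set (j # xs))" "set_cost I (set xs) \<le> budget I"
    and ys: "ys = (if set_profit I {j} \<le> set_profit I (set xs) then xs else [j])"
  shows "trimmed I (j # xs) ys (set_profit I (set ys))"
proof -
  have "feasible_set I (set xs)" "feasible_set I {j}"
    using xs inst compatible_subset[OF xs(3)]
    by (auto simp: feasible_set_def set_cost_def mdsp_instance_def)
  moreover have "set_profit I (set (j # xs)) = set_profit I {j} + set_profit I (set xs)"
    using xs(1) by (simp add: set_profit_def)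
  ultimately show ?thesis using ys by (auto simp: trimmed_def)
qed

text \<open>An open slot is left as it is; nonnegative profits give \<open>p <= 2 * p\<close>, so it
  can be treated like a closed one.\<close>

lemma trimmed_open_slot:
  assumes "mdsp_instance I" "feasible_set I (set xs)"
  shows "trimmed I xs xs (set_profit I (set xs))"
proof -
  have "0 \<le> set_profit I (set xs)"
    unfolding set_profit_def
    by (rule sum_nonneg) (use assms in \<open>auto simp: feasible_set_def mdsp_instance_def\<close>)
  then show ?thesis using assms by (simp add: trimmed_def)
qed

text \<open>The final argument freed from computations: it holds for every state and every sorted
  ranking that a run may reach.\<close>

lemma solution_of_ranking:
  assumes inst: "mdsp_instance I" and inv: "greedy_invariant I (set slots) A s"
    and trimmed: "\<And>i. i \<in> set slots \<Longrightarrow> trimmed I (slot_set s i) (slot_set s' i) (slot_profit s' i)"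
    and opt: "opt_profit I m \<le> (\<Sum>i\<in>set slots. set_profit I (set (slot_set s i)))"
    and slots: "distinct slots" "m \<le> length slots" "length slots \<le> 2 * m"
    and ranking: "mset ranking = mset slots"
      "sorted_wrt (\<lambda>a b. slot_profit s' b \<le> slot_profit s' a) ranking"
  defines "out \<equiv> map (\<lambda>i. (i, slot_set s' i)) (take m ranking)"
  shows "feasible_solution I m (solution_of out) \<and>
    total_profit I (solution_of out) \<ge> 1 / 4 * opt_profit I m"
proof
  have rank: "set ranking = set slots" "length ranking = length slots" "distinct ranking"
    using mset_eq_setD[OF ranking(1)] mset_eq_length[OF ranking(1)] slots(1) ranking(1)
      mset_eq_imp_distinct_iff by auto
  have sol: "solution_of out = map (\<lambda>i. set (slot_set s' i)) (take m ranking)"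
    by (simp add: out_def solution_of_def)
  have len: "length (take m ranking) = m" using rank slots by simp
  have slot: "ranking ! a \<in> set slots" if "a < m" for a
    using that rank slots by (metis nth_mem order_less_le_trans)
  have pos: "0 \<le> slot_profit s' i" if "i \<in> set slots" for i
  proof -
    have "slot_profit s' i = set_profit I (set (slot_set s' i))" "set (slot_set s' i) \<subseteq> deliveries I"
      using trimmed[OF that] by (auto simp: trimmed_def feasible_set_def)
    then show ?thesis
      using inst unfolding set_profit_def mdsp_instance_def by (auto intro: sum_nonneg)
  qed
  show "feasible_solution I m (solution_of out)"
    unfolding feasible_solution_def
  proof (intro conjI ballI allI impI)
    show "length (solution_of out) = m" using len by (simp add: sol)
  next
    fix S assume "S \<in> set (solution_of out)"
    then obtain i where "i \<in> set slots" "S = set (slot_set s' i)"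
      using rank(1) set_take_subset[of m ranking] by (auto simp: sol)
    then show "feasible_set I S" using trimmed[of i] by (simp add: trimmed_def)
  next
    fix a b assume ab: "a < m" "b < m" "a \<noteq> b"
    then have "ranking ! a \<noteq> ranking ! b"
      \<comment> \<open>The ranking is a permutation of distinct slots, so different positions are
        different slots, whose sets were disjoint before trimming.\<close>
      using rank slots by (simp add: nth_eq_iff_index_eq)
    then have "set (slot_set s (ranking ! a)) \<inter> set (slot_set s (ranking ! b)) = {}"
      using greedy_invariantD(6)[OF inv] slot[OF ab(1)] slot[OF ab(2)]
      unfolding disjoint_family_on_def by blast
    then have "set (slot_set s' (ranking ! a)) \<inter> set (slot_set s' (ranking ! b)) = {}"
      using trimmed[OF slot[OF ab(1)]] trimmed[OF slot[OF ab(2)]] unfolding trimmed_def by blast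
    then show "solution_of out ! a \<inter> solution_of out ! b = {}"
      using ab len by (simp add: sol)
  qed
  have "opt_profit I m \<le> (\<Sum>i\<in>set slots. 2 * slot_profit s' i)"
  proof (rule order_trans[OF opt sum_mono])
    show "set_profit I (set (slot_set s i)) \<le> 2 * slot_profit s' i" if "i \<in> set slots" for i
      using trimmed[OF that] by (simp add: trimmed_def)
  qed
  also have "\<dots> = 2 * sum_list (map (slot_profit s') ranking)"
    using rank sum_list_distinct_conv_sum_set[of ranking "slot_profit s'"]
    by (simp add: sum_distrib_left)
  also have "\<dots> \<le> 2 * (2 * sum_list (take m (map (slot_profit s') ranking)))"
    using ranking(2) rank slots pos
    by (intro mult_left_mono sum_list_take_ge_half) (auto simp: sorted_wrt_map)
  also have "take m (map (slot_profit s') ranking) = map (set_profit I) (solution_of out)"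
    using trimmed rank(1) set_take_subset[of m ranking]
    by (auto simp: sol take_map trimmed_def)
  finally show "total_profit I (solution_of out) \<ge> 1 / 4 * opt_profit I m"
    by (simp add: total_profit_def)
qed

section \<open>Binary lengths\<close>

text \<open>The fraction need not be in lowest terms, so that sums can be bounded without reducing them.\<close>

definition rat_size_le :: "nat \<Rightarrow> real \<Rightarrow> bool" where
  "rat_size_le k x \<longleftrightarrow> (\<exists>a b :: int. x = of_int a / of_int b \<and> 0 < b \<and> \<bar>a\<bar> \<le> 2 ^ k \<and> b \<le> 2 ^ k)"

lemma rat_size_leI:
  "x = of_int a / of_int b \<Longrightarrow> 0 < b \<Longrightarrow> \<bar>a\<bar> \<le> 2 ^ k \<Longrightarrow> b \<le> 2 ^ k \<Longrightarrow> rat_size_le k x"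
  by (auto simp: rat_size_le_def)

lemma rat_size_le_mono:
  assumes "rat_size_le k x" "k \<le> l" shows "rat_size_le l x"
proof -
  have "(2::int) ^ k \<le> 2 ^ l" using assms(2) by simp
  then show ?thesis
    using assms(1) unfolding rat_size_le_def by (elim exE, intro exI conjI) (auto intro: order_trans)
qed

lemma The_real_of_rat [simp]: "(THE r. real_of_rat r = of_rat q) = q"
  by (rule the_equality) auto

lemma rat_size_le_num_bits:
  assumes "x \<in> \<rat>" shows "rat_size_le (num_bits x) x"
proof -
  obtain q where q: "x = of_rat q" using assms by (auto elim: Rats_cases)
  obtain a b where ab: "quotient_of q = (a, b)" by force
  have b: "0 < b" using quotient_of_denom_pos[OF ab] .
  have bits: "num_bits x = 1 + nat (bitlen \<bar>a\<bar>) + nat (bitlen b)"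
    by (simp add: num_bits_def q ab)
  have le: "y \<le> 2 ^ num_bits x" if "0 \<le> y" "nat (bitlen y) \<le> num_bits x" for y
  proof -
    have "y < 2 ^ nat (bitlen y)"
      using bitlen_le_iff_power[of y "nat (bitlen y)"] bitlen_nonneg[of y] by simp
    also have "(2::int) ^ nat (bitlen y) \<le> 2 ^ num_bits x" using that by simp
    finally show ?thesis by simp
  qed
  have "x = of_int a / of_int b"
    using quotient_of_div[OF ab] by (simp add: q of_rat_divide)
  then show ?thesis
    by (rule rat_size_leI) (use b le[of "\<bar>a\<bar>"] le[of b] bits in auto)
qed

text \<open>Dividing by the gcd does not enlarge numerator or denominator. Each is at most
  \<open>2 ^ k\<close>, which itself has \<open>k + 1\<close> bits; with the sign bit this makes
  \<open>2 * (k + 1) + 1\<close>.\<close>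

lemma num_bits_le:
  assumes "rat_size_le k x" shows "num_bits x \<le> 2 * k + 3"
proof -
  obtain a b :: int where ab: "x = of_int a / of_int b" "0 < b" "\<bar>a\<bar> \<le> 2 ^ k" "b \<le> 2 ^ k"
    using assms by (auto simp: rat_size_le_def)
  let ?g = "gcd a b"
  have g: "0 < ?g" using ab(2) by auto
  have x: "x = of_rat (Fract a b)" using ab by (simp add: of_rat_rat)
  have q: "quotient_of (Fract a b) = (a div ?g, b div ?g)"
    using ab(2) by (simp add: quotient_of_Fract Rat.normalize_def Let_def)
  have bits: "num_bits x = 1 + nat (bitlen \<bar>a div ?g\<bar>) + nat (bitlen (b div ?g))"
    by (simp add: num_bits_def x q)
  have le: "nat (bitlen y) \<le> Suc k" if "y \<le> 2 ^ k" for y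
  proof -
    have "(0::int) < 2 ^ k" by simp
    then have "y < 2 ^ Suc k" using that unfolding power_Suc by linarith
    then have "bitlen y \<le> int (Suc k)" by (simp only: bitlen_le_iff_power nat_int) simp
    then show ?thesis by linarith
  qed
  have div_le: "\<bar>y div ?g\<bar> \<le> \<bar>y\<bar>" if "?g dvd y" for y
  proof -
    have "\<bar>y\<bar> = \<bar>y div ?g\<bar> * ?g"
      using that g by (metis abs_mult abs_of_pos dvd_div_mult_self)
    moreover have "\<bar>y div ?g\<bar> * 1 \<le> \<bar>y div ?g\<bar> * ?g" using g by (intro mult_left_mono; linarith)
    ultimately show ?thesis by simp
  qed
  have "\<bar>a div ?g\<bar> \<le> 2 ^ k" "b div ?g \<le> 2 ^ k" using div_le[of a] div_le[of b] ab by auto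
  then have "nat (bitlen \<bar>a div ?g\<bar>) \<le> Suc k" "nat (bitlen (b div ?g)) \<le> Suc k"
    using le by auto
  then show ?thesis using bits by simp
qed

text \<open>Over the common denominator \<open>b * d\<close> the numerator is a sum of two terms of
  size at most \<open>2 ^ (k + l)\<close>, whence the extra 1. Exponents add, so sums of many
  numbers stay linear in the total length.\<close>

lemma rat_size_le_add:
  assumes "rat_size_le k x" "rat_size_le l y" shows "rat_size_le (k + l + 1) (x + y)"
proof -
  obtain a b c d :: int where ab: "x = of_int a / of_int b" "0 < b" "\<bar>a\<bar> \<le> 2 ^ k" "b \<le> 2 ^ k"
    and cd: "y = of_int c / of_int d" "0 < d" "\<bar>c\<bar> \<le> 2 ^ l" "d \<le> 2 ^ l"
    using assms by (auto simp: rat_size_le_def)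
  have "x + y = of_int (a * d + c * b) / of_int (b * d)"
    using ab(2) cd(2) unfolding ab(1) cd(1) by (simp add: field_simps)
  moreover have "\<bar>a * d + c * b\<bar> \<le> 2 ^ (k + l + 1)"
  proof -
    have "\<bar>a * d + c * b\<bar> \<le> \<bar>a\<bar> * d + \<bar>c\<bar> * b"
      using ab(2) cd(2) by (metis abs_mult abs_of_pos abs_triangle_ineq)
    also have "\<dots> \<le> 2 ^ k * 2 ^ l + 2 ^ l * 2 ^ k"
      using ab cd by (intro add_mono mult_mono) auto
    finally show ?thesis by (simp add: power_add)
  qed
  moreover have "b * d \<le> 2 ^ (k + l + 1)"
  proof -
    have "b * d \<le> 2 ^ k * 2 ^ l" using ab cd by (intro mult_mono) auto
    also have "\<dots> \<le> 2 ^ (k + l + 1)" by (simp add: power_add)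
    finally show ?thesis .
  qed
  ultimately show ?thesis using ab(2) cd(2) by (intro rat_size_leI[of _ "a * d + c * b" "b * d"]) simp_all
qed

lemma rat_size_le_divide:
  assumes "rat_size_le k x" "rat_size_le l y" "0 < y" shows "rat_size_le (k + l) (x / y)"
proof -
  obtain a b c d :: int where ab: "x = of_int a / of_int b" "0 < b" "\<bar>a\<bar> \<le> 2 ^ k" "b \<le> 2 ^ k"
    and cd: "y = of_int c / of_int d" "0 < d" "\<bar>c\<bar> \<le> 2 ^ l" "d \<le> 2 ^ l"
    using assms(1,2) by (auto simp: rat_size_le_def)
  have c: "0 < c" using assms(3) cd(1,2) by (simp add: zero_less_divide_iff)
  have "x / y = of_int (a * d) / of_int (b * c)" by (simp add: ab(1) cd(1))
  moreover have "\<bar>a * d\<bar> \<le> 2 ^ (k + l)"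
    unfolding abs_mult power_add using ab cd by (intro mult_mono) auto
  moreover have "b * c \<le> 2 ^ (k + l)"
    unfolding power_add using ab cd c by (intro mult_mono) auto
  ultimately show ?thesis using ab(2) c by (intro rat_size_leI[of _ "a * d" "b * c"]) simp_all
qed

lemma rat_size_le_sum:
  assumes "finite S" "\<And>j. j \<in> S \<Longrightarrow> g j \<in> \<rat>"
  shows "rat_size_le (\<Sum>j\<in>S. num_bits (g j) + 1) (sum g S)"
  using assms
proof (induction S rule: finite_induct)
  case empty
  show ?case by (rule rat_size_leI[of _ 0 1]) auto
next
  case (insert j S)
  then have "rat_size_le (num_bits (g j) + (\<Sum>j\<in>S. num_bits (g j) + 1) + 1) (g j + sum g S)"
    by (intro rat_size_le_add rat_size_le_num_bits) auto
  then show ?case using insert.hyps by (simp add: algebra_simps)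
qed

section \<open>Encoding length and the numbers that occur\<close>

lemma num_bits_pos: "0 < num_bits x"
  by (simp add: num_bits_def split: prod.split)

definition delivery_bits :: "mdsp \<Rightarrow> nat \<Rightarrow> nat" where
  "delivery_bits I j = num_bits (t_left I j) + num_bits (t_right I j) + num_bits (cost I j) + num_bits (profit I j)"

lemma encoding_length_ge:
  "num_drones I \<le> encoding_length I" "num_deliveries I \<le> encoding_length I"
  "num_bits (budget I) \<le> encoding_length I"
  "S \<subseteq> deliveries I \<Longrightarrow> sum (delivery_bits I) S \<le> encoding_length I"
proof -
  have E: "encoding_length I = num_drones I + num_bits (budget I) + sum (delivery_bits I) (deliveries I)"
    by (simp add: encoding_length_def delivery_bits_def)
  show "num_drones I \<le> encoding_length I" "num_bits (budget I) \<le> encoding_length I" by (simp_all add: E)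
  have "(\<Sum>j\<in>deliveries I. 1) \<le> sum (delivery_bits I) (deliveries I)"
    by (rule sum_mono) (use num_bits_pos in \<open>auto simp: delivery_bits_def Suc_le_eq\<close>)
  then show "num_deliveries I \<le> encoding_length I" by (simp add: E deliveries_def)
  show "sum (delivery_bits I) S \<le> encoding_length I" if "S \<subseteq> deliveries I"
    using sum_mono2[OF finite_deliveries that, of "delivery_bits I"] by (simp add: E)
qed

text \<open>Every number is built from the data of distinct deliveries, each used at most once, so
  its size is bounded by the sum of their \<open>delivery_bits\<close>, a part of the encoding
  length.\<close>

lemma numbers_rat_size:
  assumes inst: "mdsp_instance I" and rat: "rational_instance I" and x: "x \<in> numbers I"
  shows "rat_size_le (encoding_length I) x"
proof -
  have R: "budget I \<in> \<rat>" "\<And>j. j \<in> deliveries I \<Longrightarrow> t_left I j \<in> \<rat> \<and> t_right I j \<in> \<rat> \<and> cost I j \<in> \<rat> \<and> profit I j \<in> \<rat>"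
    using rat by (auto simp: rational_instance_def)
  have single: "delivery_bits I j \<le> encoding_length I" if "j \<in> deliveries I" for j
    using encoding_length_ge(4)[of "{j}" I] that by simp
  consider "x = budget I" | j where "j \<in> deliveries I" "x = t_left I j" | j where "j \<in> deliveries I" "x = t_right I j"
    | j where "j \<in> deliveries I" "x = profit I j / cost I j"
    | S where "S \<subseteq> deliveries I" "x = set_cost I S" | S where "S \<subseteq> deliveries I" "x = set_profit I S"
    using x unfolding numbers_def by blast
  then show ?thesis
  proof cases
    case 1
    show ?thesis unfolding 1
      by (rule rat_size_le_mono[OF rat_size_le_num_bits]) (use R(1) encoding_length_ge in auto)
  next
    case (2 j)
    show ?thesis unfolding 2(2)
      by (rule rat_size_le_mono[OF rat_size_le_num_bits])
        (use R(2)[OF 2(1)] single[OF 2(1)] in \<open>auto simp: delivery_bits_def\<close>)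
  next
    case (3 j)
    show ?thesis unfolding 3(2)
      by (rule rat_size_le_mono[OF rat_size_le_num_bits])
        (use R(2)[OF 3(1)] single[OF 3(1)] in \<open>auto simp: delivery_bits_def\<close>)
  next
    case (4 j)
    have "0 < cost I j" using inst 4(1) by (auto simp: mdsp_instance_def)
    then show ?thesis unfolding 4(2)
      by (intro rat_size_le_mono[OF rat_size_le_divide[OF rat_size_le_num_bits rat_size_le_num_bits]])
        (use R(2)[OF 4(1)] single[OF 4(1)] in \<open>auto simp: delivery_bits_def\<close>)
  next
    case (5 S)
    have "rat_size_le (\<Sum>j\<in>S. num_bits (cost I j) + 1) (set_cost I S)"
      unfolding set_cost_def by (rule rat_size_le_sum) (use 5(1) R(2) finite_subset_deliveries in auto)
    \<comment> \<open>The 1 that each addition costs is paid for by the other data of the same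
      delivery, which take at least one bit.\<close>
    moreover have "(\<Sum>j\<in>S. num_bits (cost I j) + 1) \<le> sum (delivery_bits I) S"
      by (rule sum_mono) (use num_bits_pos in \<open>auto simp: delivery_bits_def Suc_le_eq\<close>)
    ultimately show ?thesis
      unfolding 5(2) using encoding_length_ge(4)[OF 5(1)] by (blast intro: rat_size_le_mono order_trans)
  next
    case (6 S)
    have "rat_size_le (\<Sum>j\<in>S. num_bits (profit I j) + 1) (set_profit I S)"
      unfolding set_profit_def by (rule rat_size_le_sum) (use 6(1) R(2) finite_subset_deliveries in auto)
    moreover have "(\<Sum>j\<in>S. num_bits (profit I j) + 1) \<le> sum (delivery_bits I) S"
      by (rule sum_mono) (use num_bits_pos in \<open>auto simp: delivery_bits_def Suc_le_eq\<close>)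
    ultimately show ?thesis
      unfolding 6(2) using encoding_length_ge(4)[OF 6(1)] by (blast intro: rat_size_le_mono order_trans)
  qed
qed

text \<open>Each of the two operands has at most \<open>2 * encoding_length I + 3\<close>
  bits.\<close>

lemma charge_bound_bit:
  assumes "mdsp_instance I" "rational_instance I"
  shows "charge_bound bit_charge (numbers I) ((4 * encoding_length I + 6)\<^sup>2)"
proof -
  have "(num_bits x + num_bits y)\<^sup>2 \<le> (4 * encoding_length I + 6)\<^sup>2" if "x \<in> numbers I" "y \<in> numbers I" for x y
    using num_bits_le[OF numbers_rat_size[OF assms that(1)]] num_bits_le[OF numbers_rat_size[OF assms that(2)]]
    by (intro power_mono) auto
  then show ?thesis by (auto simp: charge_bound_def bit_charge_def)
qed

section \<open>The greedy algorithm\<close>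

text \<open>The bounds on the number of steps are polymorphic, so that they can also be read as
  polynomials in \<open>N\<close>.\<close>

definition assign_bound :: "'a::comm_semiring_1 \<Rightarrow> 'a \<Rightarrow> 'a" where
  "assign_bound N K = (2 * N + 1) * (1 + (N + 1) * (1 + 2 * K)) +
     (2 * N + (K + (K + (1 + (K + 2 * N)))))"

text \<open>The first \<open>2 * N\<close> pays for the filter, since \<open>last_added\<close> is a
  singleton when a slot is trimmed; the four equal products are the four totals.\<close>

definition trim_bound :: "'a::comm_semiring_1 \<Rightarrow> 'a \<Rightarrow> 'a" where
  "trim_bound N K = 2 * N + ((N + 1) * (1 + K) + ((N + 1) * (1 + K) + (K +
     ((N + 1) * (1 + K) + ((N + 1) * (1 + K) + 1)))))"

definition sort_bound :: "'a::comm_semiring_1 \<Rightarrow> 'a \<Rightarrow> 'a" where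
  "sort_bound N K = (N + 1) * (1 + (N + 1) * (2 * K + 3))"

text \<open>The nesting mirrors the sequence of binds in \<open>greedy_mdsp\<close>, so that
  \<open>within_bind\<close> yields this sum term by term. The second sort ranks up to
  \<open>2 * N\<close> slots.\<close>

definition greedy_bound :: "'a::comm_semiring_1 \<Rightarrow> 'a \<Rightarrow> 'a" where
  "greedy_bound N K = N + ((N + 1) * (1 + (N + 1) * (1 + 2 * K)) + (2 * N + ((N + 1) * (1 + K) +
     (sort_bound N K + ((N + 1) * (N + 1 + assign_bound N K) + ((N + 1) * (1 + trim_bound N K) +
     (sort_bound (2 * N) K + N)))))))"

section \<open>The loops and the whole algorithm\<close>

context
  fixes I :: mdsp and C :: "real \<Rightarrow> real \<Rightarrow> nat" and K N :: nat
  assumes inst: "mdsp_instance I" and K: "charge_bound C (numbers I) K"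
    and N: "num_deliveries I \<le> N" "num_drones I \<le> N"
    and degree: "max_degree I \<le> num_drones I"
begin

lemma length_distinct_deliveries_le: "distinct xs \<Longrightarrow> set xs \<subseteq> deliveries I \<Longrightarrow> length xs \<le> N"
  using length_le_num_deliveries N(1) order_trans by blast

lemma within_assign:
  assumes inv: "greedy_invariant I slots A s" and A: "A \<subseteq> deliveries I"
    and j: "j \<in> deliveries I" "j \<notin> A"
    and many: "max_degree I < length (open_slots s)" and slots: "card slots \<le> 2 * N"
  shows "run_within (assign_bound N K) (assign C I j s)
    (\<lambda>s'. greedy_invariant I slots (insert j A) s' \<and>
          length (closed_slots s') \<le> Suc (length (closed_slots s)))"
    (is "run_within _ _ ?Post")
proof -
  note D = greedy_invariantD[OF inv]
  let ?free = "\<lambda>i. \<forall>k\<in>set (slot_set s i). interval I j \<inter> interval I k = {}"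
  have len: "length (open_slots s) \<le> 2 * N" using D(14) slots by simp
  have cand: "run_within ((2 * N + 1) * (1 + (N + 1) * (1 + 2 * K))) (candidate_slots C I s j (open_slots s))
      (\<lambda>r. r = filter ?free (open_slots s))"
  proof (rule within_mono[OF within_candidate_slots[OF inst K j(1)]])
    show "distinct (slot_set s i) \<and> set (slot_set s i) \<subseteq> deliveries I" if "i \<in> set (open_slots s)" for i
      using that D(3,7,8) A by blast
    show "Suc (length (open_slots s)) * (1 + Suc (num_deliveries I) * (1 + 2 * K)) \<le>
        (2 * N + 1) * (1 + (N + 1) * (1 + 2 * K))"
      by (intro mult_le_mono add_mono) (use len N(1) in auto)
  qed
  show ?thesis
    unfolding assign_def assign_bound_def Let_def
  proof (rule within_bind[OF cand], goal_cases)
    case (1 r)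
    \<comment> \<open>The only choice in the algorithm that could face an empty list.\<close>
    have "r \<noteq> []" using ex_open_slot[OF inv A j many] by (auto simp: 1 filter_empty_conv)
    moreover have "length r \<le> 2 * N" using len by (simp add: 1 order_trans[OF length_filter_le])
    ultimately have pick: "run_within (2 * N) (pick r) (\<lambda>i. i \<in> set (open_slots s) \<and> ?free i)"
      by (intro within_mono[OF within_pick]) (auto simp: 1)
    show ?case
    proof (rule within_bind[OF pick], goal_cases)
      case (1 i)
      then have i: "i \<in> set (open_slots s)" "?free i" "i \<in> slots" using D(3) by auto
      have S: "set (slot_set s i) \<subseteq> deliveries I" "j \<notin> set (slot_set s i)"
        using D(7)[OF i(3)] A j by auto
      \<comment> \<open>The running cost is recognised as the cost of a set of deliveries, which
        puts the operand of the budget test into \<open>numbers I\<close>.\<close>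
      have sums: "slot_cost s i + cost I j = set_cost I (insert j (set (slot_set s i)))"
        using D(10)[OF i(3)] S(2) by (simp add: set_cost_def)
      have nums: "slot_cost s i \<in> numbers I" "slot_profit s i \<in> numbers I"
        "slot_cost s i + cost I j \<in> numbers I"
        unfolding sums using D(10,11)[OF i(3)] S(1) j(1) by (auto intro: numbersI)
      note add = within_num_op(1)[OF K nums(1) cost_in_numbers[OF j(1)]]
        within_num_op(1)[OF K nums(2) profit_in_numbers[OF j(1)]]
      note less = within_num_op(4)[OF K numbersI(1) nums(3)]
      show ?case
      proof (rule within_bind[OF add(1)], hypsubst, rule within_bind[OF add(2)], hypsubst,
          rule within_bind[OF within_tick], rule within_bind[OF less], rule within_if, goal_cases)
        case (1 _ _ _ over)
        then show ?case
          using greedy_invariant_add(2)[OF inv i(1) j(2) i(2) refl] len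
          by (intro within_mono[OF within_bind_return[OF within_tick, where Q = ?Post]]) auto
      next
        case (2 _ _ _ over)
        then show ?case
          using greedy_invariant_add(1)[OF inv i(1) j(2) i(2) refl]
          by (intro within_mono[OF within_return[of ?Post]]) auto
      qed
    qed
  qed
qed

text \<open>Splitting the input into a processed prefix and a rest preserves the order, from which
  the density comparison is read off later. The loop tests for equality with
  \<open>num_drones I\<close>; since each round closes at most one slot, the count cannot jump past
  it.\<close>

lemma within_assign_loop:
  assumes "greedy_invariant I slots A s" "A \<subseteq> deliveries I" "distinct js" "set js \<subseteq> deliveries I - A"
    "length (closed_slots s) \<le> num_drones I" "card slots = num_drones I + max_degree I"
  shows "run_within (Suc (length js) * (N + 1 + assign_bound N K)) (assign_loop C I js s)
    (\<lambda>s'. \<exists>xs ys. js = xs @ ys \<and> greedy_invariant I slots (A \<union> set xs) s' \<and>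
       (ys = [] \<or> length (closed_slots s') = num_drones I) \<and> length (closed_slots s') \<le> num_drones I)"
  using assms
proof (induction js arbitrary: s A)
  case Nil
  then show ?case
    unfolding assign_loop.simps
    by (intro within_mono[OF within_bind_return[OF within_tick,
          where Q = "\<lambda>s'. greedy_invariant I slots A s' \<and> length (closed_slots s') \<le> num_drones I"]]) auto
next
  case (Cons j js)
  let ?Post = "\<lambda>s'. \<exists>xs ys. j # js = xs @ ys \<and> greedy_invariant I slots (A \<union> set xs) s' \<and>
    (ys = [] \<or> length (closed_slots s') = num_drones I) \<and> length (closed_slots s') \<le> num_drones I"
  let ?U = "Suc (length js) * (N + 1 + assign_bound N K)"
  have body: "run_within (assign_bound N K + ?U)
      (if length (closed_slots s) = num_drones I then return s
       else bind_comp (assign C I j s) (\<lambda>s'. assign_loop C I js s')) ?Post"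
  proof (rule within_if)
    assume stop: "length (closed_slots s) = num_drones I"
    then have "?Post s" using Cons.prems(1) by (intro exI[of _ "[]"] exI[of _ "j # js"]) auto
    then show "run_within (assign_bound N K + ?U) (return s) ?Post"
      by (intro within_mono[OF within_return[of ?Post]]) auto
  next
    assume cont: "length (closed_slots s) \<noteq> num_drones I"
    \<comment> \<open>Open and closed slots together number \<open>m + \<Delta>\<close>, and fewer
      than \<open>m\<close> are closed.\<close>
    have many: "max_degree I < length (open_slots s)"
      using cont Cons.prems(5,6) greedy_invariantD(14)[OF Cons.prems(1)] by simp
    have slots: "card slots \<le> 2 * N" using Cons.prems(6) N(2) degree by simp
    have j: "j \<in> deliveries I" "j \<notin> A" using Cons.prems(4) by auto
    show "run_within (assign_bound N K + ?U)
        (bind_comp (assign C I j s) (\<lambda>s'. assign_loop C I js s')) ?Post"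
    proof (rule within_bind[OF within_assign[OF Cons.prems(1,2) j many slots]], elim conjE)
      fix s' assume s': "greedy_invariant I slots (insert j A) s'"
        "length (closed_slots s') \<le> Suc (length (closed_slots s))"
      have loop: "run_within ?U (assign_loop C I js s')
        (\<lambda>s'. \<exists>xs ys. js = xs @ ys \<and> greedy_invariant I slots (insert j A \<union> set xs) s' \<and>
          (ys = [] \<or> length (closed_slots s') = num_drones I) \<and> length (closed_slots s') \<le> num_drones I)"
        by (rule Cons.IH[OF s'(1)]) (use Cons.prems s'(2) cont in auto)
      show "run_within ?U (assign_loop C I js s') ?Post"
      proof (rule within_mono[OF loop order_refl], elim exE conjE)
        fix s'' xs ys
        assume *: "js = xs @ ys" "greedy_invariant I slots (insert j A \<union> set xs) s''"
          "ys = [] \<or> length (closed_slots s'') = num_drones I" "length (closed_slots s'') \<le> num_drones I"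
        then show "?Post s''" by (intro exI[of _ "j # xs"] exI[of _ ys]) auto
      qed
    qed
  qed
  have "run_within (Suc (length (closed_slots s)) + (assign_bound N K + ?U)) (assign_loop C I (j # js) s) ?Post"
    unfolding assign_loop.simps by (rule within_bind[OF within_tick body])
  then show ?case by (rule within_mono) (use Cons.prems(5) N(2) in auto)
qed

text \<open>The ranking reads sets through the output and slots through their profits, so the new
  cost \<open>w\<close> may remain unspecified.\<close>

lemma within_trim_slot:
  assumes i: "distinct (slot_set s i)" "set (slot_set s i) \<subseteq> deliveries I" "compatible I (set (slot_set s i))"
    and last: "slot_set s i = j # xs" "last_added s i = [j]" "set_cost I (set xs) \<le> budget I"
  shows "run_within (trim_bound N K) (trim_slot C I i s)
    (\<lambda>s'. \<exists>ys w p. trimmed I (slot_set s i) ys p \<and> s' = s\<lparr> slot_set := (slot_set s)(i := ys),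
        slot_cost := (slot_cost s)(i := w), slot_profit := (slot_profit s)(i := p) \<rparr>)"
    (is "run_within _ _ ?Post")
proof -
  \<comment> \<open>By distinctness, removing \<open>j\<close> removes the head only.\<close>
  have R: "filter (\<lambda>k. k \<notin> set [j]) (j # xs) = xs"
    using i(1) last(1) by (auto simp: filter_id_conv)
  have xs: "distinct xs" "set xs \<subseteq> deliveries I" "distinct [j]" "set [j] \<subseteq> deliveries I"
    using i last(1) by auto
  have len: "length (j # xs) * Suc (length [j]) \<le> 2 * N"
    using length_distinct_deliveries_le[OF i(1,2)] last(1) by simp
  have list_total: "run_within ((N + 1) * (1 + K)) (list_total C (profit I) ks) (\<lambda>r. r = set_profit I (set ks))"
    "run_within ((N + 1) * (1 + K)) (list_total C (cost I) ks) (\<lambda>r. r = set_cost I (set ks))"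
    if "distinct ks" "set ks \<subseteq> deliveries I" for ks
  proof -
    have le: "Suc (num_deliveries I) * (1 + K) \<le> (N + 1) * (1 + K)"
      by (rule mult_le_mono1) (use N(1) in simp)
    show "run_within ((N + 1) * (1 + K)) (list_total C (profit I) ks) (\<lambda>r. r = set_profit I (set ks))"
      unfolding set_profit_def
      by (rule within_mono[OF within_list_total[OF inst K _ that] le])
        (auto simp: numbersI(6) set_profit_def[symmetric])
    show "run_within ((N + 1) * (1 + K)) (list_total C (cost I) ks) (\<lambda>r. r = set_cost I (set ks))"
      unfolding set_cost_def
      by (rule within_mono[OF within_list_total[OF inst K _ that] le])
        (auto simp: numbersI(5) set_cost_def[symmetric])
  qed
  note le = within_num_op(3)[OF K numbersI(6)[OF xs(4)] numbersI(6)[OF xs(2)]]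
  show ?thesis
    unfolding trim_slot_def trim_bound_def Let_def last(1,2) R
  proof (rule within_bind[OF within_mono[OF within_tick len]], rule TrueI,
      rule within_bind[OF list_total(1)[OF xs(1,2)]], hypsubst,
      rule within_bind[OF list_total(1)[OF xs(3,4)]], hypsubst, rule within_bind[OF le], goal_cases)
    case (1 _ _ _ keep)
    let ?T = "if keep then xs else [j]"
    have T: "distinct ?T" "set ?T \<subseteq> deliveries I" using xs by auto
    have "trimmed I (j # xs) ?T (set_profit I (set ?T))"
      using trimmed_closed_slot[OF inst _ _ _ last(3), of j ?T] i 1 by (simp add: last(1))
    then have post: "?Post (s\<lparr> slot_set := (slot_set s)(i := ?T), slot_cost := (slot_cost s)(i := w),
        slot_profit := (slot_profit s)(i := set_profit I (set ?T)) \<rparr>)" for w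
      unfolding last(1) by blast
    show ?case
      by (rule within_bind[OF list_total(2)[OF T]], rule within_bind[OF list_total(1)[OF T]], hypsubst,
          rule within_bind_return[OF within_tick]) (use post in \<open>simp add: last(1)\<close>)
  qed
qed

text \<open>Distinctness ensures that a slot is still untouched when its turn comes and is left
  alone afterwards; the \<open>else\<close> branch of the postcondition carries this through the
  induction.\<close>

lemma within_trim_loop:
  assumes "distinct is"
    and "\<And>i. i \<in> set is \<Longrightarrow> distinct (slot_set s i) \<and> set (slot_set s i) \<subseteq> deliveries I \<and>
      compatible I (set (slot_set s i)) \<and>
      (\<exists>j xs. slot_set s i = j # xs \<and> last_added s i = [j] \<and> set_cost I (set xs) \<le> budget I)"
  shows "run_within (Suc (length is) * (1 + trim_bound N K)) (trim_loop C I is s)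
    (\<lambda>s'. \<forall>k. if k \<in> set is then trimmed I (slot_set s k) (slot_set s' k) (slot_profit s' k)
        else slot_set s' k = slot_set s k \<and> slot_profit s' k = slot_profit s k)"
  using assms
proof (induction "is" arbitrary: s)
  case Nil
  show ?case
    unfolding trim_loop.simps
    by (rule within_mono[OF within_bind_return[OF within_tick, where Q = "\<lambda>s'. s' = s"]]) auto
next
  case (Cons i "is")
  let ?Post = "\<lambda>is s s'. \<forall>k. if k \<in> set is
    then trimmed I (slot_set s k) (slot_set s' k) (slot_profit s' k)
    else slot_set s' k = slot_set s k \<and> slot_profit s' k = slot_profit s k"
  let ?U = "Suc (length is) * (1 + trim_bound N K)"
  obtain j xs where i: "distinct (slot_set s i)" "set (slot_set s i) \<subseteq> deliveries I"
    "compatible I (set (slot_set s i))" "slot_set s i = j # xs" "last_added s i = [j]"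
    "set_cost I (set xs) \<le> budget I"
    using Cons.prems(2)[of i] by auto
  have "run_within (1 + (trim_bound N K + ?U)) (trim_loop C I (i # is) s) (?Post (i # is) s)"
    unfolding trim_loop.simps
  proof (rule within_bind[OF within_tick], rule within_bind[OF within_trim_slot[OF i]], elim exE conjE)
    fix s' ys w p
    assume ys: "trimmed I (slot_set s i) ys p" and s': "s' = s\<lparr> slot_set := (slot_set s)(i := ys),
        slot_cost := (slot_cost s)(i := w), slot_profit := (slot_profit s)(i := p) \<rparr>"
    have same: "slot_set s' k = slot_set s k" "last_added s' k = last_added s k"
      "slot_profit s' k = slot_profit s k" if "k \<noteq> i" for k
      using that by (simp_all add: s')
    have "run_within ?U (trim_loop C I is s') (?Post is s')"
    proof (rule Cons.IH)
      fix k assume "k \<in> set is"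
      then have "k \<in> set (i # is)" "k \<noteq> i" using Cons.prems(1) by auto
      then show "distinct (slot_set s' k) \<and> set (slot_set s' k) \<subseteq> deliveries I \<and>
        compatible I (set (slot_set s' k)) \<and>
        (\<exists>j xs. slot_set s' k = j # xs \<and> last_added s' k = [j] \<and> set_cost I (set xs) \<le> budget I)"
        using Cons.prems(2)[of k] by (simp add: same)
    qed (use Cons.prems(1) in simp)
    then show "run_within ?U (trim_loop C I is s') (?Post (i # is) s)"
    proof (rule within_mono[OF _ order_refl])
      fix s'' assume post: "?Post is s' s''"
      show "?Post (i # is) s s''"
      proof
        fix k
        show "if k \<in> set (i # is) then trimmed I (slot_set s k) (slot_set s'' k) (slot_profit s'' k)
          else slot_set s'' k = slot_set s k \<and> slot_profit s'' k = slot_profit s k"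
          using post[rule_format, of k] ys Cons.prems(1) by (cases "k = i") (auto simp: s')
      qed
    qed
  qed
  then show ?case by (rule within_mono) auto
qed

lemma within_greedy_mdsp:
  "run_within (greedy_bound N K) (greedy_mdsp C I)
     (\<lambda>out. feasible_solution I (num_drones I) (solution_of out) \<and>
            total_profit I (solution_of out) \<ge> 1 / 4 * opt_profit I (num_drones I))"
  (is "run_within _ _ ?Post")
proof -
  define m where "m = num_drones I"
  let ?js = "[1..<Suc (num_deliveries I)]" and ?slots = "[1..<Suc (m + max_degree I)]"
  have js: "set ?js = deliveries I" "distinct ?js" "length ?js \<le> N"
    using N(1) by (auto simp: deliveries_def)
  \<comment> \<open>The degree assumption enters here: \<open>m + \<Delta>\<close> slots are at most
    \<open>2 * m\<close>.\<close>
  have slots: "distinct ?slots" "length ?slots = m + max_degree I" "m \<le> length ?slots" "length ?slots \<le> 2 * m"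
    "card (set ?slots) = m + max_degree I" "length ?slots \<le> 2 * N"
    using degree N(2) by (auto simp: m_def distinct_card simp del: upt_Suc set_upt)
  have deg: "run_within ((N + 1) * (1 + (N + 1) * (1 + 2 * K))) (compute_max_degree C I ?js)
      (\<lambda>r. r = max_degree I)"
  proof (rule within_mono[OF within_compute_max_degree[OF inst K]])
    show "Suc (length ?js) * (1 + Suc (num_deliveries I) * (1 + 2 * K)) \<le>
        (N + 1) * (1 + (N + 1) * (1 + 2 * K))"
      by (intro mult_le_mono add_mono) (use js(3) N(1) in auto)
  qed (unfold js(1) max_degree_def, simp_all)
  have dens: "run_within ((N + 1) * (1 + K)) (densities C I ?js)
      (\<lambda>d. \<forall>j\<in>deliveries I. d j = profit I j / cost I j)"
  proof (rule within_mono[OF within_densities[OF inst K]])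
    show "Suc (length ?js) * (1 + K) \<le> (N + 1) * (1 + K)"
      by (intro mult_le_mono1) (use js(3) in auto)
  qed (unfold js(1), simp_all)
  have sort: "run_within (sort_bound M K) (sort_desc C key ks)
      (\<lambda>r. mset r = mset ks \<and> sorted_wrt (\<lambda>a b. key b \<le> key a) r)"
    if "key ` set ks \<subseteq> numbers I" "length ks \<le> M" for key ks M
    unfolding sort_bound_def
  proof (rule within_mono[OF within_sort_desc[OF K that(1)]])
    show "Suc (length ks) * (1 + Suc (length ks) * (2 * K + 3)) \<le> (M + 1) * (1 + (M + 1) * (2 * K + 3))"
      by (intro mult_le_mono add_mono) (use that(2) in auto)
  qed
  have B: "0 \<le> budget I" using inst by (simp add: mdsp_instance_def)
  show ?thesis
    unfolding greedy_mdsp_def greedy_bound_def Let_def m_def[symmetric]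
  proof (rule within_bind[OF within_mono[OF within_tick js(3) TrueI]], rule within_bind[OF deg], hypsubst,
      rule within_bind[OF within_mono[OF within_tick slots(6) TrueI]], rule within_bind[OF dens], goal_cases)
    case (1 _ _ _ d)
    then have d: "\<And>j. j \<in> deliveries I \<Longrightarrow> d j = profit I j / cost I j" by auto
    have keys: "d ` set ?js \<subseteq> numbers I" unfolding js(1) using d by (auto intro: numbersI)
    show ?case
    proof (rule within_bind[OF sort[OF keys js(3)]], goal_cases)
      case (1 order)
      then have sorted: "sorted_wrt (\<lambda>a b. d b \<le> d a) order" and order: "mset order = mset ?js" by auto
      have order_set: "set order = deliveries I" "distinct order" "length order = length ?js"
        using mset_eq_setD[OF order] js mset_eq_length[OF order] mset_eq_imp_distinct_iff[OF order] by auto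
      have loop: "run_within ((N + 1) * (N + 1 + assign_bound N K)) (assign_loop C I order (initial_state ?slots))
        (\<lambda>s. \<exists>xs ys. order = xs @ ys \<and> greedy_invariant I (set ?slots) (set xs) s \<and>
          (ys = [] \<or> length (closed_slots s) = m) \<and> length (closed_slots s) \<le> m)"
      proof (rule within_mono[OF within_assign_loop[OF greedy_invariant_initial[OF slots(1) B]]])
        show "Suc (length order) * (N + 1 + assign_bound N K) \<le> (N + 1) * (N + 1 + assign_bound N K)"
          by (intro mult_le_mono1) (use order_set(3) js(3) in auto)
      qed (use order_set slots(5) in \<open>auto simp: initial_state_def m_def simp del: upt_Suc set_upt\<close>)
      show ?case
      proof (rule within_bind[OF loop], elim exE conjE, goal_cases)
        case (1 s xs ys)
        note inv = 1(2)
        note D = greedy_invariantD[OF inv]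
        have xs: "set xs \<subseteq> deliveries I" using 1(1) order_set(1) by auto
        \<comment> \<open>A delivery outside \<open>xs\<close> lies in the unprocessed rest, behind
          all of \<open>xs\<close> in the order by density.\<close>
        have opt: "opt_profit I m \<le> (\<Sum>i\<in>set ?slots. set_profit I (set (slot_set s i)))"
        proof (rule opt_profit_le_assigned[OF inst inv xs])
          fix a b assume ab: "a \<in> set xs" "b \<in> deliveries I - set xs"
          then have "b \<in> set ys" using 1(1) order_set(1) by auto
          then have "d b \<le> d a" using sorted ab(1) by (auto simp: 1(1) sorted_wrt_append)
          then show "profit I b / cost I b \<le> profit I a / cost I a" using d ab xs by auto
        qed (use 1 order_set(1) in auto)
        have closed: "i \<in> set (closed_slots s) \<Longrightarrow> distinct (slot_set s i) \<and> set (slot_set s i) \<subseteq> deliveries I \<and>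
          compatible I (set (slot_set s i)) \<and>
          (\<exists>j xs. slot_set s i = j # xs \<and> last_added s i = [j] \<and> set_cost I (set xs) \<le> budget I)" for i
          using D(4) D(7-9)[of i] D(13)[of i] xs by blast
        have trim: "run_within ((N + 1) * (1 + trim_bound N K)) (trim_loop C I (closed_slots s) s)
          (\<lambda>s'. \<forall>i\<in>set ?slots. trimmed I (slot_set s i) (slot_set s' i) (slot_profit s' i))"
        proof (rule within_mono[OF within_trim_loop[OF _ closed]])
          show "distinct (closed_slots s)" using D(1) by simp
          show "Suc (length (closed_slots s)) * (1 + trim_bound N K) \<le> (N + 1) * (1 + trim_bound N K)"
            by (intro mult_le_mono1) (use 1(4) N(2) in \<open>auto simp: m_def\<close>)
        next
          fix s' assume s': "\<forall>k. if k \<in> set (closed_slots s)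
            then trimmed I (slot_set s k) (slot_set s' k) (slot_profit s' k)
            else slot_set s' k = slot_set s k \<and> slot_profit s' k = slot_profit s k"
          show "\<forall>i\<in>set ?slots. trimmed I (slot_set s i) (slot_set s' i) (slot_profit s' i)"
          proof
            fix i assume i: "i \<in> set ?slots"
            show "trimmed I (slot_set s i) (slot_set s' i) (slot_profit s' i)"
            proof (cases "i \<in> set (closed_slots s)")
              case True
              then show ?thesis using s'[rule_format, of i] by simp
            next
              case False
              then have "i \<in> set (open_slots s)" using D(2) i by blast
              then have "feasible_set I (set (slot_set s i))"
                using D(7,9,10)[OF i] D(12)[of i] xs by (auto simp: feasible_set_def)
              then show ?thesis
                using trimmed_open_slot[OF inst] s'[rule_format, of i] False D(11)[OF i] by simp
            qed
          qed
        qed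
        show ?case
        proof (rule within_bind[OF trim], goal_cases)
          case (1 s')
          then have trimmed: "\<And>i. i \<in> set ?slots \<Longrightarrow> trimmed I (slot_set s i) (slot_set s' i) (slot_profit s' i)"
            by blast
          \<comment> \<open>The keys of the second sort are profits of sets of deliveries, so its
            comparisons stay within \<open>numbers I\<close>.\<close>
          have keys: "slot_profit s' ` set ?slots \<subseteq> numbers I"
            using trimmed by (auto simp: trimmed_def feasible_set_def numbersI(6) simp del: upt_Suc set_upt)
          show ?case
          proof (rule within_bind[OF sort[OF keys slots(6)]], elim conjE,
              rule within_bind_return[OF within_mono[OF within_tick _ TrueI]], goal_cases)
            case (2 ranking)
            then show ?case
              by (intro solution_of_ranking[OF inst inv trimmed opt slots(1,3,4)])
          qed (use N(2) in \<open>simp add: m_def\<close>)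
        qed
      qed
    qed
  qed
qed

end

text \<open>The bound is built from sums, products and numerals, with which evaluation commutes.
  Read over polynomials it therefore is the required polynomial.\<close>

lemma poly_greedy_bound:
  "poly (greedy_bound P Q) x = greedy_bound (poly P x) (poly Q x)"
  by (simp add: greedy_bound_def sort_bound_def assign_bound_def trim_bound_def)

lemma guarantees_if_run_within:
  "run_within T c P \<Longrightarrow> (\<And>x t. t \<le> T \<Longrightarrow> P x \<Longrightarrow> Q x t) \<Longrightarrow> guarantees c Q"
  unfolding run_within_def guarantees_def by blast

theorem theorem5:
  shows
    "(\<forall>I C. mdsp_instance I \<longrightarrow> max_degree I \<le> num_drones I \<longrightarrow>
        guarantees (greedy_mdsp C I) (\<lambda>out t.
          feasible_solution I (num_drones I) (solution_of out) \<and>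
          total_profit I (solution_of out) \<ge> 1 / 4 * opt_profit I (num_drones I)))
     \<and> (\<exists>q :: nat poly. \<forall>I. mdsp_instance I \<longrightarrow> max_degree I \<le> num_drones I \<longrightarrow>
        guarantees (greedy_mdsp unit_charge I) (\<lambda>out t.
          t \<le> poly q (num_deliveries I + num_drones I)))
     \<and> (\<exists>q :: nat poly. \<forall>I. mdsp_instance I \<longrightarrow> rational_instance I \<longrightarrow>
        max_degree I \<le> num_drones I \<longrightarrow>
        guarantees (greedy_mdsp bit_charge I) (\<lambda>out t.
          t \<le> poly q (encoding_length I)))"
proof (intro conjI allI impI)
  fix I and C :: "real \<Rightarrow> real \<Rightarrow> nat"
  assume I: "mdsp_instance I" "max_degree I \<le> num_drones I"
  \<comment> \<open>An arbitrary charge is still bounded on finitely many pairs of numbers; the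
    resulting time bound is discarded and correctness remains.\<close>
  let ?charges = "(\<lambda>(x, y). C x y) ` (numbers I \<times> numbers I)"
  have "finite ?charges" using finite_numbers by simp
  then have "charge_bound C (numbers I) (Max ?charges)"
    by (auto simp: charge_bound_def intro!: Max_ge)
  then show "guarantees (greedy_mdsp C I) (\<lambda>out t.
      feasible_solution I (num_drones I) (solution_of out) \<and>
      total_profit I (solution_of out) \<ge> 1 / 4 * opt_profit I (num_drones I))"
    by (rule guarantees_if_run_within[OF within_greedy_mdsp[OF I(1) _ le_add1 le_add2 I(2)]])
next
  \<comment> \<open>\<open>[:0, 1:]\<close> is the identity polynomial, standing for
    \<open>N = num_deliveries I + num_drones I\<close>, and \<open>K\<close> is 1.\<close>
  have "guarantees (greedy_mdsp unit_charge I) (\<lambda>out t.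
      t \<le> poly (greedy_bound [:0, 1:] 1) (num_deliveries I + num_drones I))"
    if I: "mdsp_instance I" "max_degree I \<le> num_drones I" for I
  proof (rule guarantees_if_run_within[OF within_greedy_mdsp[OF I(1) _ le_add1 le_add2 I(2)]])
    show "charge_bound unit_charge (numbers I) 1" by (simp add: charge_bound_def unit_charge_def)
  qed (simp add: poly_greedy_bound)
  then show "\<exists>q :: nat poly. \<forall>I. mdsp_instance I \<longrightarrow> max_degree I \<le> num_drones I \<longrightarrow>
        guarantees (greedy_mdsp unit_charge I) (\<lambda>out t. t \<le> poly q (num_deliveries I + num_drones I))"
    by blast
next
  \<comment> \<open>\<open>[:6, 4:]\<close> is the polynomial \<open>4 * x + 6\<close>, whose square
    is the charge bound at the encoding length.\<close>
  have "guarantees (greedy_mdsp bit_charge I) (\<lambda>out t.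
      t \<le> poly (greedy_bound [:0, 1:] ([:6, 4:]\<^sup>2)) (encoding_length I))"
    if I: "mdsp_instance I" "rational_instance I" "max_degree I \<le> num_drones I" for I
    by (rule guarantees_if_run_within[OF within_greedy_mdsp[OF I(1) charge_bound_bit[OF I(1,2)]
          encoding_length_ge(2,1) I(3)]])
      (simp add: poly_greedy_bound algebra_simps)
  then show "\<exists>q :: nat poly. \<forall>I. mdsp_instance I \<longrightarrow> rational_instance I \<longrightarrow>
        max_degree I \<le> num_drones I \<longrightarrow>
        guarantees (greedy_mdsp bit_charge I) (\<lambda>out t. t \<le> poly q (encoding_length I))"
    by blast
qed

end
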